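(* The set $\mathrm{orb}(\mathsf S_T)$ of point orbits of $\mathsf S_T$ consists exactly of the following elements: (1) the singletons $\{T\}$, $\{T^\phi\}$, $\{T^{\phi^2}\}$; (2) one Type-II-$T$-sls, one Type-II-$T^\phi$-sls and one Type-II-$T^{\phi^2}$-sls; (3) $q-2$ Type-III-$T$-slses, $q-2$ Type-III-$T^\phi$-slses and $q-2$ Type-III-$T^{\phi^2}$-slses; (4) $\mathcal P_{2,q}$, which contains only Type I points and only Type I lines; (5) $q^3-q-3$ $\mathbb{F}_q$-planes which consist of only Type II points and only Type III lines; (6) $q^3-q-3$ $\mathbb{F}_q$-planes which consist of only Type III points and only Type II lines; (7) $q^4-3q^3+q+6$ $\mathbb{F}_q$-planes which consist of only Type III points and only Type III lines.
   Context: Let $q$ be a prime power, $\mathbb{F}_q$ the field of order $q$, $\mathbb{F}_{q^3}^*=\mathbb{F}_{q^3}\setminus\{0\}$. Points of $\mathrm{PG}(2,q^3)$ have homogeneous coordinates $(x,y,z)$ and lines $[a,b,c]$, a point lying on a line iff the dot product of the coordinate vectors is $0$. An $\mathbb{F}_q$-plane is a subplane of order $q$ of $\mathrm{PG}(2,q^3)$; its lines are the lines of $\mathrm{PG}(2,q^3)$ meeting it in $q+1$ points. Let $\phi$ be the collineation $(x,y,z)\mapsto(z^q,x^q,y^q)$, acting on lines by $[d,e,f]\mapsto[f^q,d^q,e^q]$; its fixed points form the $\mathbb{F}_q$-plane $\mathcal P_{2,q}=\{(x,x^q,x^{q^2}):x\in\mathbb{F}_{q^3}^*\}$. A point has Type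 I, II or III according as its $\phi$-orbit is one point, three collinear points, or three non-collinear points; a line has Type I, II or III according as its $\phi$-orbit is one line, three concurrent lines, or three non-concurrent lines (equivalently, it meets $\mathcal P_{2,q}$ in $q+1$, $1$ or $0$ points). Let $T=(0,0,1)$, so $T^\phi=(1,0,0)$, $T^{\phi^2}=(0,1,0)$. For $t\in\mathbb{F}_{q^3}^*$ let $\psi_t$ be the collineation $(x,y,z)\mapsto(tx,t^qy,t^{q^2}z)$, and let $\mathsf S_T=\{\psi_t: t\in\mathbb{F}_{q^3}^*\}$ (the subgroup of $\mathrm{PGL}(3,q^3)$ fixing $\mathcal P_{2,q}$ setwise and the line $T^\phi T^{\phi^2}$ setwise). $\mathrm{orb}(\mathsf S_T)$ denotes the set of point orbits of $\mathsf S_T$. The point orbits of $\mathsf S_T$ of size $q^2+q+1$ contained in the line $T^\phi T^{\phi^2}$ (respectively $T^{\phi^2}T$, $TT^\phi$) are called $T$-slses (respectively $T^\phi$-slses, $T^{\phi^2}$-slses). Such an sls is called Type-X (X $\in\{$II, III$\}$) if all its points have Type X. *)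

theory Defs
  imports Main "HOL-Computational_Algebra.Primes"
begin

text \<open>Homogeneous coordinate vectors are triples over the field 'a (playing the
role of F_{q^3}).  A point (or a line) of PG(2,q^3) is represented as the set of
all nonzero scalar multiples of a nonzero coordinate vector.\<close>

type_synonym 'a vec3 = "'a \<times> 'a \<times> 'a"

definition smul :: "'a::field \<Rightarrow> 'a vec3 \<Rightarrow> 'a vec3" where
  "smul c v = (case v of (x, y, z) \<Rightarrow> (c * x, c * y, c * z))"

definition dot :: "'a::field vec3 \<Rightarrow> 'a vec3 \<Rightarrow> 'a" where
  "dot v w = (case v of (x, y, z) \<Rightarrow> case w of (d, e, f) \<Rightarrow> x * d + y * e + z * f)"

definition pt :: "'a::field vec3 \<Rightarrow> 'a vec3 set" where
  "pt v = {smul c v | c. c \<noteq> 0}"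

definition Pts :: "'a::field vec3 set set" where
  "Pts = {pt v | v. v \<noteq> (0, 0, 0)}"

definition Lns :: "'a::field vec3 set set" where
  "Lns = {pt v | v. v \<noteq> (0, 0, 0)}"

definition inc :: "'a::field vec3 set \<Rightarrow> 'a vec3 set \<Rightarrow> bool" where
  "inc P L = (\<exists>v\<in>P. \<exists>w\<in>L. dot v w = 0)"

definition on_line :: "'a::field vec3 set \<Rightarrow> 'a vec3 set set" where
  "on_line L = {P \<in> Pts. inc P L}"

definition join :: "'a::field vec3 set \<Rightarrow> 'a vec3 set \<Rightarrow> 'a vec3 set" where
  "join P Q = (THE L. L \<in> Lns \<and> inc P L \<and> inc Q L)"

definition collinear3 :: "'a::field vec3 set \<Rightarrow> 'a vec3 set \<Rightarrow> 'a vec3 set \<Rightarrow> bool" where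
  "collinear3 P Q R = (\<exists>L\<in>Lns. inc P L \<and> inc Q L \<and> inc R L)"

definition concurrent3 :: "'a::field vec3 set \<Rightarrow> 'a vec3 set \<Rightarrow> 'a vec3 set \<Rightarrow> bool" where
  "concurrent3 L M N = (\<exists>P\<in>Pts. inc P L \<and> inc P M \<and> inc P N)"

text \<open>The collineation phi: (x,y,z) maps to (z^q,x^q,y^q); on lines [d,e,f] maps to
[f^q,d^q,e^q] (the same coordinate formula).\<close>
definition phi_vec :: "nat \<Rightarrow> 'a::field vec3 \<Rightarrow> 'a vec3" where
  "phi_vec q v = (case v of (x, y, z) \<Rightarrow> (z ^ q, x ^ q, y ^ q))"

definition phi :: "nat \<Rightarrow> 'a::field vec3 set \<Rightarrow> 'a vec3 set" where
  "phi q P = phi_vec q ` P"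

definition phi_orbit :: "nat \<Rightarrow> 'a::field vec3 set \<Rightarrow> 'a vec3 set set" where
  "phi_orbit q P = {P, phi q P, phi q (phi q P)}"

definition pt_typeI :: "nat \<Rightarrow> 'a::field vec3 set \<Rightarrow> bool" where
  "pt_typeI q P = (card (phi_orbit q P) = 1)"

definition pt_typeII :: "nat \<Rightarrow> 'a::field vec3 set \<Rightarrow> bool" where
  "pt_typeII q P = (card (phi_orbit q P) = 3 \<and> collinear3 P (phi q P) (phi q (phi q P)))"

definition pt_typeIII :: "nat \<Rightarrow> 'a::field vec3 set \<Rightarrow> bool" where
  "pt_typeIII q P = (card (phi_orbit q P) = 3 \<and> \<not> collinear3 P (phi q P) (phi q (phi q P)))"

definition ln_typeI :: "nat \<Rightarrow> 'a::field vec3 set \<Rightarrow> bool" where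
  "ln_typeI q L = (card (phi_orbit q L) = 1)"

definition ln_typeII :: "nat \<Rightarrow> 'a::field vec3 set \<Rightarrow> bool" where
  "ln_typeII q L = (card (phi_orbit q L) = 3 \<and> concurrent3 L (phi q L) (phi q (phi q L)))"

definition ln_typeIII :: "nat \<Rightarrow> 'a::field vec3 set \<Rightarrow> bool" where
  "ln_typeIII q L = (card (phi_orbit q L) = 3 \<and> \<not> concurrent3 L (phi q L) (phi q (phi q L)))"

definition Fq_plane :: "nat \<Rightarrow> 'a::field vec3 set set \<Rightarrow> bool" where
  "Fq_plane q S =
    (S \<subseteq> Pts \<and>
     (\<exists>A\<in>S. \<exists>B\<in>S. \<exists>C\<in>S. \<exists>D\<in>S.
        distinct [A, B, C, D] \<and> \<not> collinear3 A B C \<and> \<not> collinear3 A B D \<and>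
        \<not> collinear3 A C D \<and> \<not> collinear3 B C D) \<and>
     (\<forall>P\<in>S. \<forall>Q\<in>S. P \<noteq> Q \<longrightarrow>
        (\<exists>L\<in>Lns. inc P L \<and> inc Q L \<and> card (on_line L \<inter> S) = q + 1)) \<and>
     (\<forall>L\<in>Lns. \<forall>M\<in>Lns. L \<noteq> M \<and> 2 \<le> card (on_line L \<inter> S) \<and> 2 \<le> card (on_line M \<inter> S)
        \<longrightarrow> (\<exists>P\<in>S. inc P L \<and> inc P M)))"

definition plane_lines :: "nat \<Rightarrow> 'a::field vec3 set set \<Rightarrow> 'a vec3 set set" where
  "plane_lines q S = {L \<in> Lns. card (on_line L \<inter> S) = q + 1}"

definition P2q :: "nat \<Rightarrow> 'a::field vec3 set set" where
  "P2q q = {pt (x, x ^ q, x ^ (q ^ 2)) | x. x \<noteq> 0}"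

definition psi :: "nat \<Rightarrow> 'a::field \<Rightarrow> 'a vec3 set \<Rightarrow> 'a vec3 set" where
  "psi q t P = (\<lambda>(x, y, z). (t * x, t ^ q * y, t ^ (q ^ 2) * z)) ` P"

definition ST_orbit :: "nat \<Rightarrow> 'a::field vec3 set \<Rightarrow> 'a vec3 set set" where
  "ST_orbit q P = {psi q t P | t. t \<noteq> 0}"

definition orbST :: "nat \<Rightarrow> 'a::field vec3 set set set" where
  "orbST q = {ST_orbit q P | P. P \<in> Pts}"

definition Tpt :: "'a::field vec3 set" where "Tpt = pt (0, 0, 1)"

text \<open>Orbits of size q^2+q+1 contained in the line L (L = join of the other two
of T, T^phi, T^{phi^2}).\<close>
definition sls_on :: "nat \<Rightarrow> 'a::field vec3 set \<Rightarrow> 'a vec3 set set \<Rightarrow> bool" where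
  "sls_on q L X = (X \<in> orbST q \<and> card X = q ^ 2 + q + 1 \<and> X \<subseteq> on_line L)"

end

theory Submission
  imports Defs "HOL-Computational_Algebra.Polynomial"
begin

text \<open>A point \<open>v = (x, y, z)\<close> with \<open>x y z \<noteq> 0\<close> has as orbit the image
  of \<open>P2q\<close> under \<open>diag(x, y, z)\<close>, hence an \<open>F_q\<close>-plane, whose lines form the orbit of the
  line \<open>[1/x, 1/y, 1/z]\<close>. All points of an orbit have the same type, read off from the vanishing of
  the determinant of \<open>v\<close>, \<open>\<phi> v\<close>, \<open>\<phi> (\<phi> v)\<close>. An orbit of Type II meets the line \<open>[1, 1, 1]\<close> in exactly
  one point; of the \<open>q^3 - 2\<close> points of this line off the triangle, \<open>q + 1\<close> are fixed by \<open>\<phi>\<close>, which leaves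
  \<open>q^3 - q - 3\<close> such planes. The map \<open>v \<mapsto> (1/x, 1/y, 1/z)\<close> turns them into the planes with Type II lines. No plane has both its points and its lines of Type II. On a side of the triangle
  the orbits are the fibres of the norm, and Type II means norm \<open>-1\<close>.\<close>

section \<open>Homogeneous coordinates\<close>

text \<open>A Type II point and its images span a line fixed by \<open>phi\<close>. The group
  permutes the fixed lines transitively, so some point of the orbit lies on [1, 1, 1]. If two
  different points of one orbit lay there, then one of them would lie on two different fixed lines
  and so be fixed itself; this makes the representative unique. The number of all planes is (q^3 -
  1) * (q - 1), the (q^3 - 1)^2 points off the triangle divided by the orbit size q^2 + q + 1. The
  planes of item (7) are counted as what remains after the others are removed. The field is given by
  its cardinality alone. F_q occurs only as the solutions of \<open>fr x = x\<close>, and Hilbert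
  90, the surjectivity of the norm and the size of the trace kernel all come from comparing fibre
  sizes with bounds on numbers of roots.\<close>

declare split_paired_Ex [simp del] split_paired_All [simp del]

text \<open>Coordinates of the line through two points and of the meet of two lines;
  \<open>dot u (cross v w)\<close> is the determinant with rows u, v, w.\<close>

definition cross :: "'a::field vec3 \<Rightarrow> 'a vec3 \<Rightarrow> 'a vec3" where
  "cross v w = (case v of (a, b, c) \<Rightarrow> case w of (d, e, f) \<Rightarrow>
     (b * f - c * e, c * d - a * f, a * e - b * d))"

lemma cross_simp [simp]: "cross (a, b, c) (d, e, f) = (b * f - c * e, c * d - a * f, a * e - b * d)"
  by (simp add: cross_def)

lemma smul_simp [simp]: "smul c (x, y, z) = (c * x, c * y, c * z)"
  by (simp add: smul_def)

lemma dot_simp [simp]: "dot (x, y, z) (d, e, f) = x * d + y * e + z * f"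
  by (simp add: dot_def)

lemma dot_zero [simp]: "dot v (0, 0, 0) = 0" "dot (0, 0, 0) v = 0"
  by (simp_all add: dot_def split: prod.splits)

lemma smul_one [simp]: "smul 1 v = v"
  by (cases v) simp

lemma smul_smul: "smul a (smul b v) = smul (a * b) v"
  by (cases v) (simp add: mult.assoc)

lemma smul_eq_0_iff: "smul c v = (0, 0, 0) \<longleftrightarrow> c = 0 \<or> v = (0, 0, 0)"
  by (cases v) auto

lemma dot_commute: "dot v w = dot w v"
  by (cases v; cases w) (simp add: mult.commute)

lemma dot_smul: "dot (smul a v) (smul b w) = a * b * dot v w"
  by (cases v; cases w) (simp add: algebra_simps)

lemma dot_cross: "dot v (cross v w) = 0" "dot w (cross v w) = 0"
  by (cases v; cases w; simp add: algebra_simps)+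

lemma cross_eq_0_imp_smul:
  assumes "cross u n = (0, 0, 0)" "n \<noteq> (0, 0, 0)"
  shows "\<exists>c. u = smul c n"
proof -
  obtain a b c d e f where [simp]: "u = (a, b, c)" "n = (d, e, f)"
    by (cases u; cases n) auto
  have eqs: "b * f = c * e" "c * d = a * f" "a * e = b * d"
    using assms(1) by auto
  consider "d \<noteq> 0" | "e \<noteq> 0" | "f \<noteq> 0"
    using assms(2) by auto
  then show ?thesis
  proof cases
    case 1
    then show ?thesis
      by (intro exI[of _ "a / d"]) (use eqs in \<open>simp add: field_simps\<close>)
  next
    case 2
    then show ?thesis
      by (intro exI[of _ "b / e"]) (use eqs in \<open>simp add: field_simps\<close>)
  next
    case 3
    then show ?thesis
      by (intro exI[of _ "c / f"]) (use eqs in \<open>simp add: field_simps\<close>)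
  qed
qed

lemma cross_smul_self: "cross (smul c v) v = (0, 0, 0)" "cross v (smul c v) = (0, 0, 0)"
  by (cases v; simp)+

lemma perp_imp_smul_cross:
  assumes "dot v u = 0" "dot w u = 0" "cross v w \<noteq> (0, 0, 0)"
  shows "\<exists>c. u = smul c (cross v w)"
proof (rule cross_eq_0_imp_smul[OF _ assms(3)])
  obtain a b c d e f x y z where [simp]: "v = (a, b, c)" "w = (d, e, f)" "u = (x, y, z)"
    by (cases v; cases w; cases u) auto
  have *: "a * x + b * y + c * z = 0" "d * x + e * y + f * z = 0"
    using assms by auto
  \<comment> \<open>The triple product identity u x (v x w) = (u . w) v - (u . v) w, one coordinate
    at a time.\<close>
  have "y * (a * e - b * d) - z * (c * d - a * f) = a * (d * x + e * y + f * z) - d * (a * x + b * y + c * z)"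
    "z * (b * f - c * e) - x * (a * e - b * d) = b * (d * x + e * y + f * z) - e * (a * x + b * y + c * z)"
    "x * (c * d - a * f) - y * (b * f - c * e) = c * (d * x + e * y + f * z) - f * (a * x + b * y + c * z)"
    by algebra+
  then show "cross u (cross v w) = (0, 0, 0)"
    using * by simp
qed

lemma ex_perp2: "\<exists>n. n \<noteq> (0, 0, 0) \<and> dot v n = 0 \<and> dot w n = 0"
proof -
  have perp1: "\<exists>n. n \<noteq> (0, 0, 0) \<and> dot v n = 0" for v :: "'a vec3"
  proof -
    obtain a b c where [simp]: "v = (a, b, c)"
      by (cases v) auto
    show ?thesis
    proof (cases "a = 0")
      case True
      then show ?thesis
        by (intro exI[of _ "(1, 0, 0)"]) auto
    next
      case False
      then show ?thesis
        by (intro exI[of _ "(b, -a, 0)"]) auto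
    qed
  qed
  show ?thesis
  proof (cases "cross v w = (0, 0, 0) \<and> w \<noteq> (0, 0, 0)")
    case True
    then obtain c where c: "v = smul c w"
      using cross_eq_0_imp_smul by blast
    obtain n where "n \<noteq> (0, 0, 0)" "dot w n = 0"
        using perp1 by blast
    moreover from this have "dot v n = 0"
      using c dot_smul[of c w 1 n] by simp
    ultimately show ?thesis
      by blast
  next
    case False
    show ?thesis
    proof (cases "w = (0, 0, 0)")
      case True
      then show ?thesis
        using perp1[of v] by simp
    next
      case w: False
      then show ?thesis
        using False dot_cross[of v w] dot_cross[of w v] by blast
    qed
  qed
qed

text \<open>The determinant criterion for a homogeneous system. If \<open>cross v w\<close> is
  nonzero, it is up to scalars the only candidate for n. If it is zero, v and w are dependent and at
  most two conditions are left, which always have a common solution.\<close>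

lemma ex_perp3_iff:
  "(\<exists>n. n \<noteq> (0, 0, 0) \<and> dot u n = 0 \<and> dot v n = 0 \<and> dot w n = 0) \<longleftrightarrow> dot u (cross v w) = 0"
proof
  assume "\<exists>n. n \<noteq> (0, 0, 0) \<and> dot u n = 0 \<and> dot v n = 0 \<and> dot w n = 0"
  then obtain n where n: "n \<noteq> (0, 0, 0)" "dot u n = 0" "dot v n = 0" "dot w n = 0"
    by blast
  show "dot u (cross v w) = 0"
  proof (cases "cross v w = (0, 0, 0)")
    case True
    then show ?thesis
      by (cases u) simp
  next
    case False
    then obtain c where "n = smul c (cross v w)"
      using perp_imp_smul_cross n by blast
    moreover from this have "c \<noteq> 0"
      using n(1) by (auto simp: smul_def split: prod.splits)
    ultimately show ?thesis
      using n(2) dot_smul[of 1 u c "cross v w"] by simp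
  qed
next
  assume det: "dot u (cross v w) = 0"
  show "\<exists>n. n \<noteq> (0, 0, 0) \<and> dot u n = 0 \<and> dot v n = 0 \<and> dot w n = 0"
  proof (cases "cross v w = (0, 0, 0)")
    case False
    then show ?thesis
      using det dot_cross by blast
  next
    case True
    show ?thesis
    proof (cases "w = (0, 0, 0)")
      case True
      then show ?thesis
        using ex_perp2[of u v] by simp
    next
      case False
      then obtain c where "v = smul c w"
        using True cross_eq_0_imp_smul by blast
      then show ?thesis
        using ex_perp2[of u w] dot_smul[of c w 1] by fastforce
    qed
  qed
qed

lemma pt_self: "v \<in> pt v"
  unfolding pt_def by (auto intro!: exI[of _ 1])

lemma pt_smul: "c \<noteq> 0 \<Longrightarrow> pt (smul c v) = pt v"
  unfolding pt_def
proof (intro set_eqI iffI)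
  fix x assume c: "c \<noteq> 0" and "x \<in> {smul d v | d. d \<noteq> 0}"
  then obtain d where "x = smul d v" "d \<noteq> 0" by blast
  then show "x \<in> {smul d (smul c v) | d. d \<noteq> 0}"
    using c by (auto simp: smul_smul intro!: exI[of _ "d / c"])
qed (auto simp: smul_smul)

lemma pt_eq_iff: "pt v = pt w \<longleftrightarrow> (\<exists>c. c \<noteq> 0 \<and> v = smul c w)"
proof
  assume "pt v = pt w"
  then have "v \<in> pt w" using pt_self by blast
  then show "\<exists>c. c \<noteq> 0 \<and> v = smul c w" by (auto simp: pt_def)
qed (auto simp: pt_smul)

lemma pt_eq_iff_cross:
  assumes "v \<noteq> (0, 0, 0)" "w \<noteq> (0, 0, 0)"
  shows "pt v = pt w \<longleftrightarrow> cross v w = (0, 0, 0)"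
proof
  assume "cross v w = (0, 0, 0)"
  then obtain c where "v = smul c w"
    using assms cross_eq_0_imp_smul by blast
  moreover from this have "c \<noteq> 0"
    using assms by (auto simp: smul_eq_0_iff)
  ultimately show "pt v = pt w"
    by (simp add: pt_smul)
qed (auto simp: pt_eq_iff cross_smul_self)

lemma pt_in_Pts [simp]: "pt v \<in> Pts \<longleftrightarrow> v \<noteq> (0, 0, 0)"
  unfolding Pts_def mem_Collect_eq pt_eq_iff by (metis smul_eq_0_iff smul_one zero_neq_one)

lemma Lns_eq_Pts: "Lns = Pts"
  by (simp add: Lns_def Pts_def)

lemma PtsE:
  assumes "P \<in> Pts"
  obtains v where "P = pt v" "v \<noteq> (0, 0, 0)"
  using assms unfolding Pts_def by blast

lemma inc_pt [simp]: "inc (pt v) (pt w) \<longleftrightarrow> dot v w = 0"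
proof
  assume "inc (pt v) (pt w)"
  then obtain a b where "a \<noteq> 0" "b \<noteq> 0" "dot (smul a v) (smul b w) = 0"
    unfolding inc_def pt_def by blast
  then show "dot v w = 0"
    by (simp add: dot_smul)
qed (auto simp: inc_def intro: pt_self)

lemma inc_commute: "inc P L \<longleftrightarrow> inc L P"
  unfolding inc_def using dot_commute by metis

lemma collinear3_pt: "collinear3 (pt u) (pt v) (pt w) \<longleftrightarrow> dot u (cross v w) = 0"
proof -
  have "collinear3 (pt u) (pt v) (pt w) \<longleftrightarrow>
      (\<exists>n. n \<noteq> (0, 0, 0) \<and> dot u n = 0 \<and> dot v n = 0 \<and> dot w n = 0)"
    unfolding collinear3_def Lns_def mem_Collect_eq Bex_def using inc_pt by metis
  then show ?thesis
    by (simp add: ex_perp3_iff)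
qed

lemma concurrent3_eq_collinear3: "concurrent3 P Q R = collinear3 P Q R"
  unfolding concurrent3_def collinear3_def Lns_eq_Pts using inc_commute by blast

text \<open>Points and lines are encoded alike, incidence is symmetric and \<open>phi\<close> acts
  on both by the same formula, so every statement on line types becomes one on point types.\<close>

lemma ln_type_eq_pt_type:
  "ln_typeI q L = pt_typeI q L" "ln_typeII q L = pt_typeII q L" "ln_typeIII q L = pt_typeIII q L"
  by (simp_all add: ln_typeI_def pt_typeI_def ln_typeII_def pt_typeII_def
      ln_typeIII_def pt_typeIII_def concurrent3_eq_collinear3)

lemma join_pt:
  assumes "cross v w \<noteq> (0, 0, 0)"
  shows "join (pt v) (pt w) = pt (cross v w)"
  unfolding join_def
proof (rule the_equality)
  show "pt (cross v w) \<in> Lns \<and> inc (pt v) (pt (cross v w)) \<and> inc (pt w) (pt (cross v w))"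
    using assms by (simp add: Lns_eq_Pts dot_cross)
next
  fix L assume L: "L \<in> Lns \<and> inc (pt v) L \<and> inc (pt w) L"
  then obtain u where u: "L = pt u" "u \<noteq> (0, 0, 0)"
    unfolding Lns_eq_Pts by (blast elim: PtsE)
  then obtain c where "u = smul c (cross v w)"
    using perp_imp_smul_cross[of v u w] L assms by auto
  then show "L = pt (cross v w)"
    using u by (auto simp: smul_eq_0_iff pt_smul)
qed

section \<open>Counting in finite fields\<close>

lemma Diff_partition3: "B \<union> C \<union> D \<subseteq> A \<Longrightarrow> A = B \<union> C \<union> D \<union> (A - B - C - D)"
  by auto

lemma card_constant_fibres:
  assumes "finite A" "\<And>x. x \<in> A \<Longrightarrow> card {y \<in> A. f y = f x} = k"
  shows "card A = k * card (f ` A)"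
proof -
  have "card A = (\<Sum>y\<in>f ` A. card {x \<in> A. f x = y})"
    using sum.image_gen[OF assms(1), of "\<lambda>_. 1::nat" f] by simp
  also have "\<dots> = (\<Sum>y\<in>f ` A. k)"
    using assms(2) by (intro sum.cong) auto
  finally show ?thesis by simp
qed

text \<open>Used to count orbits through a complete invariant: if f gives the orbit and g the
  invariant, then f x and g x determine each other.\<close>

lemma card_image_cong_fibres:
  assumes "\<And>x y. x \<in> A \<Longrightarrow> y \<in> A \<Longrightarrow> f x = f y \<longleftrightarrow> g x = g y"
  shows "card (f ` A) = card (g ` A)"
proof -
  have f: "inv_into A f (f x) \<in> A" "f (inv_into A f (f x)) = f x" if "x \<in> A" for x
    using that by (auto simp: inv_into_into f_inv_into_f)
  have g: "g (inv_into A f (f x)) = g x" if "x \<in> A" for x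
    using assms f[OF that] that by blast
  then have "g ` A = (\<lambda>u. g (inv_into A f u)) ` f ` A"
    by (auto simp: image_image)
  moreover have "inj_on (\<lambda>u. g (inv_into A f u)) (f ` A)"
    by (intro inj_onI) (auto simp: g assms)
  ultimately show ?thesis
    by (simp add: card_image)
qed

lemma power_card_units_eq_1:
  fixes x :: "'a::{finite, field}"
  assumes "x \<noteq> 0"
  shows "x ^ (card (UNIV :: 'a set) - 1) = 1"
proof -
  \<comment> \<open>Multiplication by x permutes the nonzero elements.\<close>
  have "(\<Prod>y\<in>UNIV-{0}. x * y) = (\<Prod>y\<in>UNIV-{0}. y)"
    by (rule prod.reindex_bij_witness[of _ "\<lambda>y. y / x" "\<lambda>y. x * y"]) (use assms in auto)
  then have "x ^ (card (UNIV :: 'a set) - 1) * \<Prod>(UNIV-{0}) = 1 * \<Prod>(UNIV-{0::'a})"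
    by (simp add: prod.distrib)
  moreover have "\<Prod>(UNIV-{0::'a}) \<noteq> 0"
    by simp
  ultimately show ?thesis
    by (metis mult_right_cancel)
qed

lemma card_power_eq_1_le:
  fixes n :: nat
  assumes "n > 0"
  shows "card {x::'a::{finite, field}. x ^ n = 1} \<le> n"
proof -
  let ?p = "monom 1 n - 1 :: 'a poly"
  have deg: "degree ?p \<le> n"
    by (intro degree_diff_le) (auto simp: degree_monom_le)
  have "coeff ?p n = 1"
    using assms by simp
  then have "?p \<noteq> 0"
    by (metis coeff_0 zero_neq_one)
  then have "card {x. poly ?p x = 0} \<le> n"
    using card_poly_roots_bound[of ?p] deg by linarith
  then show ?thesis
    by (simp add: poly_monom)
qed

text \<open>This replaces the cyclicity of the unit group. All fibres of the m-th power map on units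
  have the size of its kernel, which is at most m, so its image has at least n elements. The image
  consists of solutions of x^n = 1, of which there are at most n; hence it is all of them.\<close>

lemma finite_field_power_eq_1:
  fixes n m :: nat
  assumes nm: "n * m = card (UNIV :: 'a::{finite, field} set) - 1" and "n > 0" "m > 0"
  shows card_power_eq_1: "card {x::'a. x ^ n = 1} = n"
    and power_eq_1_iff: "\<And>x::'a. x ^ n = 1 \<longleftrightarrow> (\<exists>t. t \<noteq> 0 \<and> x = t ^ m)"
proof -
  let ?A = "UNIV - {0 :: 'a}" and ?k = "card {x::'a. x ^ m = 1}"
  let ?I = "(\<lambda>t. t ^ m) ` ?A"
  have "card {y \<in> ?A. y ^ m = x ^ m} = ?k" if "x \<in> ?A" for x
    by (rule bij_betw_same_card[of "\<lambda>y. y / x"], rule bij_betw_byWitness[where f' = "\<lambda>y. y * x"])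
      (use that \<open>m > 0\<close> in \<open>auto simp: power_divide power_mult_distrib zero_power\<close>)
  then have "card ?A = ?k * card ?I"
    by (intro card_constant_fibres) auto
  then have eq: "n * m = ?k * card ?I"
    using nm by simp
  have sub: "?I \<subseteq> {x. x ^ n = 1}"
    using power_card_units_eq_1 nm by (auto simp flip: power_mult simp: mult.commute)
  then have le: "card ?I \<le> card {x::'a. x ^ n = 1}"
    by (intro card_mono) auto
  have "n \<le> card ?I"
  proof (rule ccontr)
    assume "\<not> n \<le> card ?I"
    then have "?k * card ?I < m * n"
      using card_power_eq_1_le[OF \<open>m > 0\<close>, where 'a = 'a] assms(2,3)
      by (metis mult_le_mono1 mult_less_mono2 not_le le_less_trans)
    then show False
      using eq by (simp add: mult.commute)
  qed
  then have c: "card ?I = n" "card {x::'a. x ^ n = 1} = n"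
    using le card_power_eq_1_le[OF \<open>n > 0\<close>, where 'a = 'a] by linarith+
  then have "?I = {x. x ^ n = 1}"
    by (intro card_subset_eq sub) auto
  then show "x ^ n = 1 \<longleftrightarrow> (\<exists>t. t \<noteq> 0 \<and> x = t ^ m)" for x :: 'a
    by blast
  show "card {x::'a. x ^ n = 1} = n"
    by (fact c)
qed

text \<open>Adding 1 to every element permutes the field and so leaves the sum of all elements
  unchanged.\<close>

lemma of_nat_card_UNIV: "of_nat (card (UNIV :: 'a set)) = (0 :: 'a::{finite, field})"
proof -
  have "(\<Sum>x\<in>UNIV. x + 1 :: 'a) = (\<Sum>x\<in>UNIV. x)"
    by (rule sum.reindex_bij_witness[of _ "\<lambda>y. y - 1" "\<lambda>y. y + 1"]) auto
  then show ?thesis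
    by (simp add: sum.distrib)
qed

section \<open>Frobenius map, norm and trace of the cubic extension\<close>

locale cubic_extension =
  fixes q :: nat and field_type :: "'a::{finite, field} itself"
  assumes prime_power: "\<exists>p k. prime p \<and> 0 < k \<and> q = p ^ k"
    and card_field: "card (UNIV :: 'a set) = q ^ 3"
begin

definition fr :: "'a \<Rightarrow> 'a" where
  "fr x = x ^ q"

definition nrm :: "'a \<Rightarrow> 'a" where
  "nrm x = x * fr x * fr (fr x)"

definition tr :: "'a \<Rightarrow> 'a" where
  "tr x = x + fr x + fr (fr x)"

lemma q_ge_2: "q \<ge> 2"
proof -
  obtain p k where pk: "prime p" "0 < k" "q = p ^ k"
    using prime_power by blast
  then have "2 \<le> p" by (simp add: prime_ge_2_nat)
  also have "p ^ 1 \<le> p ^ k" using pk by (intro power_increasing) (auto simp: prime_gt_0_nat Suc_le_eq)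
  finally show ?thesis using pk by simp
qed

lemma fr_add [simp]: "fr (x + y) = fr x + fr y"
proof -
  obtain p k where pk: "prime p" "0 < k" "q = p ^ k"
    using prime_power by blast
  have "of_nat (q ^ 3) = (0 :: 'a)"
    using of_nat_card_UNIV[where 'a = 'a] card_field by simp
  then have "of_nat p = (0 :: 'a)"
    using pk by simp
  then have "CHAR('a) dvd p"
    by (simp add: of_nat_eq_0_iff_char_dvd)
  moreover have "CHAR('a) \<noteq> 1"
    by simp
  ultimately have "CHAR('a) = p"
    using pk(1) by (metis prime_nat_iff)
  then show ?thesis
    unfolding fr_def using pk freshmans_dream'[where 'a = 'a] by blast
qed

lemma fr_mult [simp]: "fr (x * y) = fr x * fr y"
  by (simp add: fr_def power_mult_distrib)

lemma fr_divide [simp]: "fr (x / y) = fr x / fr y"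
  by (simp add: fr_def power_divide)

lemma fr_0 [simp]: "fr 0 = 0"
  using q_ge_2 by (simp add: fr_def zero_power)

lemma fr_1 [simp]: "fr 1 = 1"
  by (simp add: fr_def)

lemma fr_minus [simp]: "fr (- x) = - fr x"
  using fr_add[of x "- x"] by (simp add: eq_neg_iff_add_eq_0 add.commute del: fr_add)

lemma fr_diff [simp]: "fr (x - y) = fr x - fr y"
  using fr_add[of x "- y"] by simp

lemma fr_eq_0_iff [simp]: "fr x = 0 \<longleftrightarrow> x = 0"
  using q_ge_2 by (simp add: fr_def)

lemma fr_eq_iff [simp]: "fr x = fr y \<longleftrightarrow> x = y"
  using fr_eq_0_iff[of "x - y"] by simp

lemma power_q_square: "x ^ (q ^ 2) = fr (fr x)"
  by (simp add: fr_def power2_eq_square power_mult)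

lemma fr_fr_fr [simp]: "fr (fr (fr x)) = x"
proof (cases "x = 0")
  case False
  have "fr (fr (fr x)) = x ^ card (UNIV :: 'a set)"
    by (simp add: fr_def card_field power3_eq_cube power_mult)
  also have "\<dots> = x * x ^ (card (UNIV :: 'a set) - 1)"
    by (subst power_Suc[symmetric]) (use finite_UNIV_card_ge_0[where ?'a = 'a] in simp)
  finally show ?thesis
    using power_card_units_eq_1[OF False] by simp
qed simp

lemma units_factor: "(q - 1) * (q ^ 2 + q + 1) = card (UNIV :: 'a set) - 1"
proof -
  obtain r where "q = Suc r"
    using q_ge_2 by (cases q) auto
  then show ?thesis
    by (simp add: card_field power2_eq_square power3_eq_cube algebra_simps)
qed

lemma nrm_power: "nrm x = x ^ (q ^ 2 + q + 1)"
  by (simp add: nrm_def power_add fr_def power2_eq_square power_mult mult_ac)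

lemma fr_power_diff: "x \<noteq> 0 \<Longrightarrow> fr x / x = x ^ (q - 1)"
  using q_ge_2 by (simp add: fr_def power_diff)

lemma fr_fixed_iff: "x \<noteq> 0 \<and> fr x = x \<longleftrightarrow> x ^ (q - 1) = 1"
proof (cases "x = 0")
  case True
  then show ?thesis
    using q_ge_2 by (simp add: zero_power)
next
  case False
  then show ?thesis
    using fr_power_diff[OF False] by auto
qed

lemma card_fixed_units: "card {x. x \<noteq> 0 \<and> fr x = x} = q - 1"
  unfolding fr_fixed_iff using q_ge_2 by (intro card_power_eq_1[OF units_factor]) auto

text \<open>Surjectivity of the norm onto the units of F_q. It and \<open>hilbert_90\<close> are the
  same counting fact for the two orders of the factors q - 1 and q^2 + q + 1: the norm is the power
  q^2 + q + 1, and \<open>fr t / t\<close> is the power q - 1.\<close>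

lemma fr_fixed_iff_nrm: "x \<noteq> 0 \<and> fr x = x \<longleftrightarrow> (\<exists>t. t \<noteq> 0 \<and> x = nrm t)"
  unfolding fr_fixed_iff nrm_power using q_ge_2
  by (intro power_eq_1_iff[OF units_factor]) auto

lemma hilbert_90: "nrm x = 1 \<longleftrightarrow> (\<exists>t. t \<noteq> 0 \<and> x = fr t / t)"
proof -
  have "nrm x = 1 \<longleftrightarrow> (\<exists>t. t \<noteq> 0 \<and> x = t ^ (q - 1))"
    unfolding nrm_power using q_ge_2
    by (intro power_eq_1_iff[of _ "q - 1"]) (use units_factor in \<open>auto simp: mult.commute\<close>)
  then show ?thesis
    using fr_power_diff by metis
qed

lemma nrm_divide: "nrm (x / y) = nrm x / nrm y"
  by (simp add: nrm_def)

lemma fr_nrm: "fr (nrm x) = nrm x"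
  by (simp add: nrm_def)

lemma nrm_eq_0_iff [simp]: "nrm x = 0 \<longleftrightarrow> x = 0"
  by (simp add: nrm_def)

lemma tr_add: "tr (x + y) = tr x + tr y"
  by (simp add: tr_def)

lemma tr_diff: "tr (x - y) = tr x - tr y"
  by (simp add: tr_def)

lemma fr_tr: "fr (tr x) = tr x"
  by (simp add: tr_def add_ac)

lemma card_fixed: "card {x. fr x = x} = q"
proof -
  have "{x. fr x = x} = insert 0 {x. x \<noteq> 0 \<and> fr x = x}"
    by auto
  then show ?thesis
    using card_fixed_units q_ge_2 by simp
qed

text \<open>The trace is a polynomial of degree q^2, which bounds its zeros from above. Its values
  lie in F_q and its fibres are translates of the kernel, so the kernel has at least q^3 / q
  elements.\<close>

lemma card_tr_eq_0: "card {x. tr x = 0} = q ^ 2"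
proof (rule antisym)
  let ?p = "monom 1 (q ^ 2) + (monom 1 q + monom 1 1) :: 'a poly"
  have "1 < q" using q_ge_2 by simp
  then have q2: "q < q ^ 2" "1 < q ^ 2"
    using power_strict_increasing[of 1 2 q] by (simp_all add: one_less_power)
  then have deg: "degree ?p \<le> q ^ 2"
    by (intro degree_add_le) (auto intro!: order.trans[OF degree_monom_le])
  have "coeff ?p (q ^ 2) = 1"
    using q2 by (simp add: coeff_monom)
  then have "?p \<noteq> 0"
    by (metis coeff_0 zero_neq_one)
  then have "card {x. poly ?p x = 0} \<le> q ^ 2"
    using card_poly_roots_bound[of ?p] deg by linarith
  then show "card {x. tr x = 0} \<le> q ^ 2"
    by (simp add: poly_monom tr_def power_q_square fr_def[symmetric] add_ac)
next
  have "card {y \<in> UNIV. tr y = tr x} = card {x. tr x = 0}" for x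
    by (rule bij_betw_same_card[of "\<lambda>y. y - x"], rule bij_betw_byWitness[where f' = "\<lambda>y. y + x"])
      (auto simp: tr_add tr_diff)
  then have "q ^ 3 = card {x. tr x = 0} * card (range tr)"
    using card_constant_fibres[of UNIV tr] card_field by simp
  also have "\<dots> \<le> card {x. tr x = 0} * card {x. fr x = x}"
    by (intro mult_left_mono card_mono) (auto simp: fr_tr)
  also have "\<dots> = card {x. tr x = 0} * q"
    by (simp add: card_fixed)
  finally show "q ^ 2 \<le> card {x. tr x = 0}"
    using q_ge_2 by (simp add: power3_eq_cube power2_eq_square)
qed

lemma card_perp_units:
  assumes "a \<noteq> 0"
  shows "card {t. t \<noteq> 0 \<and> tr (t * a) = 0} = q ^ 2 - 1"
proof -
  have "card {t. t \<noteq> 0 \<and> tr (t * a) = 0} = card ({x. tr x = 0} - {0})"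
    by (rule bij_betw_same_card[of "\<lambda>t. t * a"], rule bij_betw_byWitness[where f' = "\<lambda>t. t / a"])
      (use assms in auto)
  also have "\<dots> = q ^ 2 - 1"
    by (subst card_Diff_singleton) (auto simp: card_tr_eq_0, simp add: tr_def)
  finally show ?thesis .
qed

section \<open>Orbits and subplanes\<close>

text \<open>The action of \<open>psi q t\<close> on vectors. For fixed v it is F_q-linear in t, so
  an orbit off the triangle is the projective plane of the three-dimensional F_q-space F_{q^3}, with
  t as coordinate.\<close>

definition tw :: "'a \<Rightarrow> 'a vec3 \<Rightarrow> 'a vec3" where
  "tw t v = (case v of (x, y, z) \<Rightarrow> (t * x, fr t * y, fr (fr t) * z))"

text \<open>Sends a point to the coordinates of a line of its dual plane. Since 1 / 0 = 0, it is an
  involution on all vectors.\<close>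

definition recip :: "'a vec3 \<Rightarrow> 'a vec3" where
  "recip v = (case v of (x, y, z) \<Rightarrow> (1 / x, 1 / y, 1 / z))"

text \<open>Off the sides of the coordinate triangle; the weaker \<open>two_nz\<close> only keeps a
  point away from its vertices.\<close>

definition nz :: "'a vec3 \<Rightarrow> bool" where
  "nz v = (case v of (x, y, z) \<Rightarrow> x \<noteq> 0 \<and> y \<noteq> 0 \<and> z \<noteq> 0)"

definition two_nz :: "'a vec3 \<Rightarrow> bool" where
  "two_nz v = (case v of (x, y, z) \<Rightarrow> x \<noteq> 0 \<and> y \<noteq> 0 \<or> y \<noteq> 0 \<and> z \<noteq> 0 \<or> x \<noteq> 0 \<and> z \<noteq> 0)"

abbreviation orb :: "'a vec3 \<Rightarrow> 'a vec3 set set" where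
  "orb v \<equiv> ST_orbit q (pt v)"

lemma tw_simp [simp]: "tw t (x, y, z) = (t * x, fr t * y, fr (fr t) * z)"
  by (simp add: tw_def)

lemma recip_simp [simp]: "recip (x, y, z) = (1 / x, 1 / y, 1 / z)"
  by (simp add: recip_def)

lemma nz_simp [simp]: "nz (x, y, z) \<longleftrightarrow> x \<noteq> 0 \<and> y \<noteq> 0 \<and> z \<noteq> 0"
  by (simp add: nz_def)

lemma two_nz_simp [simp]:
  "two_nz (x, y, z) \<longleftrightarrow> x \<noteq> 0 \<and> y \<noteq> 0 \<or> y \<noteq> 0 \<and> z \<noteq> 0 \<or> x \<noteq> 0 \<and> z \<noteq> 0"
  by (simp add: two_nz_def)

lemma phi_vec_simp [simp]: "phi_vec q (x, y, z) = (fr z, fr x, fr y)"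
  by (simp add: phi_vec_def fr_def)

lemma phi_vec_phi_vec_phi_vec [simp]: "phi_vec q (phi_vec q (phi_vec q v)) = (v :: 'a vec3)"
  by (cases v) simp

lemma phi_vec_eq_0_iff [simp]: "phi_vec q v = (0, 0, 0) \<longleftrightarrow> v = (0, 0, 0 :: 'a)"
  by (cases v) auto

lemma phi_vec_smul: "phi_vec q (smul c v) = smul (fr c) (phi_vec q v)"
  by (cases v) simp

lemma phi_vec_tw: "phi_vec q (tw t v) = tw t (phi_vec q v)"
  by (cases v) simp

lemma cross_phi_vec: "cross (phi_vec q v) (phi_vec q w) = phi_vec q (cross v w :: 'a vec3)"
  by (cases v; cases w) (simp add: algebra_simps)

lemma dot_phi_vec: "dot (phi_vec q v) (phi_vec q w) = fr (dot v w)"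
  by (cases v; cases w) (simp add: algebra_simps)

lemma nz_imp_two_nz: "nz v \<Longrightarrow> two_nz v"
  by (cases v) simp

lemma two_nz_imp_nonzero: "two_nz v \<Longrightarrow> v \<noteq> (0, 0, 0)"
  by (cases v) auto

lemma nz_recip [simp]: "nz (recip v) = nz v"
  by (cases v) simp

lemma recip_recip [simp]: "recip (recip v) = v"
  by (cases v) simp

lemma nz_tw: "t \<noteq> 0 \<Longrightarrow> nz (tw t v) = nz v"
  by (cases v) simp

lemma nz_smul: "t \<noteq> 0 \<Longrightarrow> nz (smul t v) = nz v"
  by (cases v) simp

lemma tw_eq_0_iff: "tw t v = (0, 0, 0) \<longleftrightarrow> t = 0 \<or> v = (0, 0, 0)"
  by (cases v) auto

lemma tw_tw: "tw s (tw t v) = tw (s * t) v"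
  by (cases v) (simp add: mult_ac)

lemma tw_1 [simp]: "tw 1 v = v"
  by (cases v) simp

lemma tw_smul: "tw t (smul c v) = smul c (tw t v)"
  by (cases v) (simp add: mult_ac)

text \<open>The coordinates of v cancel, so incidence is the trace form on the parameters, the same
  for every v. All claims about joins, meets and line sizes are thereby reduced to the
  trace.\<close>

lemma dot_tw_recip: "nz v \<Longrightarrow> dot (tw t v) (tw s (recip v)) = tr (t * s)"
  by (cases v) (simp add: tr_def)

lemma phi_pt [simp]: "phi q (pt v) = pt (phi_vec q (v :: 'a vec3))"
proof
  show "phi q (pt v) \<subseteq> pt (phi_vec q v)"
  proof
    fix x assume "x \<in> phi q (pt v)"
    then obtain c where "c \<noteq> 0" "x = phi_vec q (smul c v)"
      unfolding phi_def pt_def by blast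
    then have "fr c \<noteq> 0" "x = smul (fr c) (phi_vec q v)"
      by (simp_all add: phi_vec_smul)
    then show "x \<in> pt (phi_vec q v)"
      unfolding pt_def by blast
  qed
next
  show "pt (phi_vec q v) \<subseteq> phi q (pt v)"
  proof
    fix x assume "x \<in> pt (phi_vec q v)"
    then obtain c where c: "c \<noteq> 0" "x = smul c (phi_vec q v)"
      unfolding pt_def by blast
    then have "x = phi_vec q (smul (fr (fr c)) v)"
      by (simp add: phi_vec_smul)
    then show "x \<in> phi q (pt v)"
      unfolding phi_def pt_def using c(1) by (intro image_eqI[of _ _ "smul (fr (fr c)) v"] CollectI) auto
  qed
qed

lemma psi_pt: "psi q t (pt v) = pt (tw t v)"
proof -
  have "psi q t (pt v) = tw t ` pt v"
    by (simp add: psi_def tw_def power_q_square fr_def case_prod_unfold)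
  also have "\<dots> = pt (tw t v)"
    by (simp add: pt_def setcompr_eq_image image_image tw_smul)
  finally show ?thesis .
qed

lemma orb_eq: "orb v = (\<lambda>t. pt (tw t v)) ` (UNIV - {0})"
  by (auto simp: ST_orbit_def psi_pt)

lemma orb_tw: "t \<noteq> 0 \<Longrightarrow> orb (tw t v) = orb v"
  unfolding orb_eq tw_tw
proof (intro equalityI subsetI)
  fix x assume "t \<noteq> 0" "x \<in> (\<lambda>s. pt (tw s v)) ` (UNIV - {0})"
  then obtain s where "s \<noteq> 0" "x = pt (tw s v)" by auto
  then show "x \<in> (\<lambda>s. pt (tw (s * t) v)) ` (UNIV - {0})"
    using \<open>t \<noteq> 0\<close> by (intro image_eqI[of _ _ "s / t"]) auto
qed auto

lemma pt_in_orb: "pt v \<in> orb v"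
  unfolding orb_eq by (rule image_eqI[of _ _ 1]) auto

lemma orb_eqI: "pt w \<in> orb v \<Longrightarrow> orb w = orb v"
proof -
  assume "pt w \<in> orb v"
  then obtain t where "t \<noteq> 0" "pt w = pt (tw t v)"
    unfolding orb_eq by blast
  then show "orb w = orb v"
    using orb_tw by simp
qed

lemma orb_eq_iff: "orb w = orb v \<longleftrightarrow> (\<exists>t. t \<noteq> 0 \<and> pt w = pt (tw t v))"
proof
  assume "orb w = orb v"
  then show "\<exists>t. t \<noteq> 0 \<and> pt w = pt (tw t v)"
    using pt_in_orb[of w] by (auto simp: orb_eq)
next
  assume "\<exists>t. t \<noteq> 0 \<and> pt w = pt (tw t v)"
  then obtain t where "t \<noteq> 0" "pt w = pt (tw t v)"
    by blast
  then show "orb w = orb v"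
    using orb_tw by simp
qed

text \<open>Each nonzero coordinate of v forces one conjugate of t / s to equal the scalar c. Two
  nonzero coordinates make two of the three conjugates equal, and as \<open>fr\<close> has order
  three this already puts t / s into F_q.\<close>

lemma pt_tw_eq_iff:
  assumes "two_nz v" "t \<noteq> 0" "s \<noteq> 0"
  shows "pt (tw t v) = pt (tw s v) \<longleftrightarrow> fr (t / s) = t / s"
proof
  obtain x y z where [simp]: "v = (x, y, z)"
    by (cases v)
  assume "pt (tw t v) = pt (tw s v)"
  then obtain c where "tw t v = smul c (tw s v)"
    by (auto simp: pt_eq_iff)
  then have c: "x \<noteq> 0 \<Longrightarrow> t / s = c" "y \<noteq> 0 \<Longrightarrow> fr (t / s) = c" "z \<noteq> 0 \<Longrightarrow> fr (fr (t / s)) = c"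
    using assms by (auto simp: field_simps)
  have "fr u = u" if "fr (fr u) = u" for u
    using that fr_fr_fr[of u] by simp
  then show "fr (t / s) = t / s"
    using c assms(1) by (metis fr_eq_iff \<open>v = (x, y, z)\<close> two_nz_simp)
next
  assume *: "fr (t / s) = t / s"
  define k where "k = t / s"
  have "fr k = k" "t = k * s"
    using * assms unfolding k_def by simp_all
  then have "tw t v = smul k (tw s v)"
    by (cases v) (simp add: mult.assoc)
  then show "pt (tw t v) = pt (tw s v)"
    using assms by (simp add: pt_smul k_def)
qed

text \<open>The parameters of one point form a coset of the units of F_q. The set A is kept general
  because the count is applied both to all units and to the units whose points lie on a given
  line.\<close>

lemma card_pt_tw_fibre:
  assumes "two_nz v" "\<And>t k. k \<noteq> 0 \<Longrightarrow> fr k = k \<Longrightarrow> t \<in> A \<Longrightarrow> k * t \<in> A"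
    and "s \<in> A" "0 \<notin> A"
  shows "card {t \<in> A. pt (tw t v) = pt (tw s v)} = q - 1"
proof -
  have "s \<noteq> 0" using assms by auto
  have "card {t \<in> A. pt (tw t v) = pt (tw s v)} = card {x. x \<noteq> 0 \<and> fr x = x}"
  proof (rule bij_betw_same_card[of "\<lambda>t. t / s"], rule bij_betw_byWitness[where f' = "\<lambda>x. x * s"])
    show "(\<lambda>t. t / s) ` {t \<in> A. pt (tw t v) = pt (tw s v)} \<subseteq> {x. x \<noteq> 0 \<and> fr x = x}"
    proof
      fix k assume "k \<in> (\<lambda>t. t / s) ` {t \<in> A. pt (tw t v) = pt (tw s v)}"
      then obtain t where t: "k = t / s" "t \<in> A" "pt (tw t v) = pt (tw s v)"
        by auto
      moreover from this have "t \<noteq> 0"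
        using assms(4) by auto
      ultimately show "k \<in> {x. x \<noteq> 0 \<and> fr x = x}"
        using pt_tw_eq_iff[OF assms(1) _ \<open>s \<noteq> 0\<close>] \<open>s \<noteq> 0\<close> by simp
    qed
    show "(\<lambda>x. x * s) ` {x. x \<noteq> 0 \<and> fr x = x} \<subseteq> {t \<in> A. pt (tw t v) = pt (tw s v)}"
    proof
      fix t assume "t \<in> (\<lambda>x. x * s) ` {x. x \<noteq> 0 \<and> fr x = x}"
      then obtain k where k: "t = k * s" "k \<noteq> 0" "fr k = k"
        by auto
      then have "pt (tw t v) = pt (tw s v)"
        using pt_tw_eq_iff[OF assms(1) _ \<open>s \<noteq> 0\<close>, of t] \<open>s \<noteq> 0\<close> by simp
      then show "t \<in> {t \<in> A. pt (tw t v) = pt (tw s v)}"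
        using k assms(2,3) by blast
    qed
  qed (use \<open>s \<noteq> 0\<close> in auto)
  then show ?thesis
    by (simp add: card_fixed_units)
qed

lemma card_orb:
  assumes "two_nz v"
  shows "card (orb v) = q ^ 2 + q + 1"
proof -
  have "card (UNIV - {0 :: 'a}) = (q - 1) * card (orb v)"
    unfolding orb_eq by (intro card_constant_fibres card_pt_tw_fibre assms) auto
  then have "(q - 1) * (q ^ 2 + q + 1) = (q - 1) * card (orb v)"
    using units_factor by simp
  then show ?thesis
    using q_ge_2 by (subst (asm) nat_mult_eq_cancel1) auto
qed

lemma on_line_Int_orb:
  assumes "nz v"
  shows "on_line (pt (tw a (recip v))) \<inter> orb v =
    (\<lambda>t. pt (tw t v)) ` {t. t \<noteq> 0 \<and> tr (t * a) = 0}"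
proof -
  have "v \<noteq> (0, 0, 0)" using assms by auto
  then show ?thesis
    by (auto simp: on_line_def orb_eq dot_tw_recip[OF assms] tw_eq_0_iff)
qed

lemma card_on_line_Int_orb:
  assumes "nz v" "a \<noteq> 0"
  shows "card (on_line (pt (tw a (recip v))) \<inter> orb v) = q + 1"
proof -
  let ?A = "{t. t \<noteq> 0 \<and> tr (t * a) = 0}"
  have "tr (k * t * a) = k * tr (t * a)" if "fr k = k" for k t
    using that by (simp add: tr_def algebra_simps)
  then have "card ?A = (q - 1) * card ((\<lambda>t. pt (tw t v)) ` ?A)"
    by (intro card_constant_fibres card_pt_tw_fibre nz_imp_two_nz assms) auto
  moreover have "q ^ 2 - 1 = (q - 1) * (q + 1)"
    by (cases q) (auto simp: power2_eq_square)
  ultimately have "(q - 1) * (q + 1) = (q - 1) * card (on_line (pt (tw a (recip v))) \<inter> orb v)"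
    using card_perp_units[OF assms(2)] on_line_Int_orb[OF assms(1)] by metis
  then show ?thesis
    using q_ge_2 by (subst (asm) nat_mult_eq_cancel1) auto
qed

text \<open>The factor is the first coordinate of the cross product of (t, \<open>fr t\<close>,
  \<open>fr (fr t)\<close>) with the corresponding vector of s; the other two coordinates are its
  conjugates. Each trace is therefore a determinant with two equal rows, and the factor is the
  parameter of the line joining the points t and s.\<close>

lemma tr_cross:
  "tr (t * (fr t * fr (fr s) - fr (fr t) * fr s)) = 0"
  "tr (s * (fr t * fr (fr s) - fr (fr t) * fr s)) = 0"
  by (simp_all add: tr_def algebra_simps)

lemma pt_tw_neq_imp:
  assumes "two_nz v" "t \<noteq> 0" "s \<noteq> 0" "pt (tw t v) \<noteq> pt (tw s v)"
  shows "fr t * fr (fr s) - fr (fr t) * fr s \<noteq> 0"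
proof
  assume "fr t * fr (fr s) - fr (fr t) * fr s = 0"
  then have "fr (t * fr s) = fr (fr t * s)"
    by simp
  then have "t * fr s = fr t * s"
    by (simp only: fr_eq_iff)
  then have "fr (t / s) = t / s"
    using assms by (simp add: field_simps)
  then show False
    using assms pt_tw_eq_iff by blast
qed

text \<open>Both L and the line with parameter ?a are orthogonal to the same two independent
  vectors, hence proportional. A line with two points in an orbit is thus a line of the plane, with
  all its q + 1 points.\<close>

lemma line_of_two_points:
  assumes nz: "nz v" and L: "L \<in> Lns" "P \<in> on_line L \<inter> orb v" "Q \<in> on_line L \<inter> orb v" "P \<noteq> Q"
  shows "\<exists>a. a \<noteq> 0 \<and> L = pt (tw a (recip v))"
proof -
  obtain t s where ts: "P = pt (tw t v)" "Q = pt (tw s v)" "t \<noteq> 0" "s \<noteq> 0"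
    using L by (auto simp: orb_eq)
  let ?a = "fr t * fr (fr s) - fr (fr t) * fr s"
  have a: "?a \<noteq> 0"
    using pt_tw_neq_imp[OF nz_imp_two_nz[OF nz]] ts L by blast
  obtain l where l: "L = pt l" "l \<noteq> (0, 0, 0)"
    using L(1) unfolding Lns_eq_Pts by (blast elim: PtsE)
  have v0: "v \<noteq> (0, 0, 0)" "recip v \<noteq> (0, 0, 0)"
    using nz by (auto simp: two_nz_imp_nonzero nz_imp_two_nz)
  have "cross (tw t v) (tw s v) \<noteq> (0, 0, 0)"
    using ts L v0 pt_eq_iff_cross[of "tw t v" "tw s v"] by (auto simp: tw_eq_0_iff)
  moreover have "dot (tw t v) l = 0" "dot (tw s v) l = 0"
    using L ts l by (auto simp: on_line_def)
  moreover have "dot (tw t v) (tw ?a (recip v)) = 0" "dot (tw s v) (tw ?a (recip v)) = 0"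
    using dot_tw_recip[OF nz] tr_cross by auto
  ultimately obtain c d where
    "l = smul c (cross (tw t v) (tw s v))" "tw ?a (recip v) = smul d (cross (tw t v) (tw s v))"
    using perp_imp_smul_cross by metis
  moreover have "tw ?a (recip v) \<noteq> (0, 0, 0)"
    using a v0 by (simp add: tw_eq_0_iff)
  ultimately have "pt l = pt (tw ?a (recip v))"
    using l by (metis pt_smul smul_eq_0_iff)
  then show ?thesis
    using a l by blast
qed

lemma two_points_on_line:
  assumes "2 \<le> card (on_line L \<inter> orb v)"
  obtains P Q where "P \<in> on_line L \<inter> orb v" "Q \<in> on_line L \<inter> orb v" "P \<noteq> Q"
  using assms by (metis card_le_Suc0_iff_eq finite_Int finite not_less_eq_eq numeral_2_eq_2)

text \<open>The lines of a plane are again a point orbit, so their types can be read off from the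
  single vector \<open>recip v\<close>.\<close>

lemma plane_lines_orb:
  assumes "nz v"
  shows "plane_lines q (orb v) = orb (recip v)"
proof (intro equalityI subsetI)
  fix L assume "L \<in> plane_lines q (orb v)"
  then have L: "L \<in> Lns" "2 \<le> card (on_line L \<inter> orb v)"
    using q_ge_2 by (auto simp: plane_lines_def)
  then obtain a where "a \<noteq> 0" "L = pt (tw a (recip v))"
    using line_of_two_points[OF assms] by (metis two_points_on_line)
  then show "L \<in> orb (recip v)"
    by (auto simp: orb_eq)
next
  fix L assume "L \<in> orb (recip v)"
  then obtain a where "a \<noteq> 0" "L = pt (tw a (recip v))"
    by (auto simp: orb_eq)
  then show "L \<in> plane_lines q (orb v)"
    using assms nz_imp_two_nz[of "recip v"] two_nz_imp_nonzero[of "recip v"]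
    by (auto simp: plane_lines_def Lns_eq_Pts card_on_line_Int_orb tw_eq_0_iff)
qed

lemma P2q_eq_orb: "P2q q = orb (1, 1, 1)"
  by (auto simp: P2q_def orb_eq power_q_square fr_def[symmetric])

lemma pt_tw_cancel: "t \<noteq> 0 \<Longrightarrow> pt (tw t v) = pt (tw t w) \<longleftrightarrow> pt v = pt w"
proof
  assume t: "t \<noteq> 0" and eq: "pt (tw t v) = pt (tw t w)"
  have "psi q (1 / t) (pt (tw t v)) = psi q (1 / t) (pt (tw t w))"
    by (simp only: eq)
  then show "pt v = pt w"
    using t by (simp add: psi_pt tw_tw)
next
  assume "pt v = pt w"
  then show "pt (tw t v) = pt (tw t w)"
    by (simp flip: psi_pt)
qed

section \<open>Types of points as invariants of orbits\<close>

definition phi_det :: "'a vec3 \<Rightarrow> 'a" where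
  "phi_det v = dot v (cross (phi_vec q v) (phi_vec q (phi_vec q v)))"

text \<open>\<open>tw t\<close> commutes with \<open>phi_vec q\<close>, so it multiplies all three
  rows, and its own determinant is \<open>nrm t\<close>.\<close>

lemma phi_det_tw: "phi_det (tw t v) = nrm t * phi_det v"
  by (cases v) (simp add: phi_det_def nrm_def algebra_simps)

lemma phi_pt_cancel: "pt (phi_vec q v) = pt (phi_vec q w) \<longleftrightarrow> pt v = pt (w :: 'a vec3)"
proof
  assume "pt (phi_vec q v) = pt (phi_vec q w)"
  then have "phi q (phi q (pt (phi_vec q v))) = phi q (phi q (pt (phi_vec q w)))"
    by (simp only:)
  then show "pt v = pt w"
    by simp
qed (simp flip: phi_pt)

lemma card_phi_orbit:
  "card (phi_orbit q (pt v)) = (if pt (phi_vec q v) = pt (v :: 'a vec3) then 1 else 3)"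
proof (cases "pt (phi_vec q v) = pt v")
  case True
  then have "phi_orbit q (pt v) = {pt v}"
    using phi_pt_cancel[of "phi_vec q v" v] by (simp add: phi_orbit_def)
  then show ?thesis
    using True by simp
next
  case False
  then have "pt (phi_vec q (phi_vec q v)) \<noteq> pt (phi_vec q v)"
    "pt (phi_vec q (phi_vec q v)) \<noteq> pt v"
    using phi_pt_cancel[of "phi_vec q v" v] phi_pt_cancel[of "phi_vec q (phi_vec q v)" v] by auto
  then show ?thesis
    using False by (auto simp: phi_orbit_def)
qed

lemma pt_typeI_iff: "pt_typeI q (pt v) \<longleftrightarrow> pt (phi_vec q v) = pt (v :: 'a vec3)"
  by (simp add: pt_typeI_def card_phi_orbit)

lemma pt_typeII_iff:
  "pt_typeII q (pt v) \<longleftrightarrow> pt (phi_vec q v) \<noteq> pt v \<and> phi_det v = 0"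
  by (simp add: pt_typeII_def card_phi_orbit collinear3_pt phi_det_def)

lemma phi_det_eq_0_if_fixed: "pt (phi_vec q v) = pt v \<Longrightarrow> phi_det v = 0"
proof -
  assume "pt (phi_vec q v) = pt v"
  then obtain c where "phi_vec q v = smul c v"
    by (auto simp: pt_eq_iff)
  moreover have "dot v (cross (smul c v) w) = 0" for w
    by (cases v; cases w) (simp add: algebra_simps)
  ultimately show ?thesis
    by (simp add: phi_det_def)
qed

lemma pt_typeIII_iff: "pt_typeIII q (pt v) \<longleftrightarrow> phi_det v \<noteq> 0"
  using phi_det_eq_0_if_fixed[of v]
  by (auto simp: pt_typeIII_def card_phi_orbit collinear3_pt phi_det_def)

lemma pt_type_tw:
  assumes "t \<noteq> 0"
  shows "pt_typeI q (pt (tw t v)) = pt_typeI q (pt v)"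
    "pt_typeII q (pt (tw t v)) = pt_typeII q (pt v)"
    "pt_typeIII q (pt (tw t v)) = pt_typeIII q (pt v)"
  using assms
  by (simp_all add: pt_typeI_iff pt_typeII_iff pt_typeIII_iff phi_vec_tw pt_tw_cancel phi_det_tw)

lemma orb_type:
  "(\<forall>P\<in>orb v. pt_typeI q P) \<longleftrightarrow> pt_typeI q (pt v)"
  "(\<forall>P\<in>orb v. pt_typeII q P) \<longleftrightarrow> pt_typeII q (pt v)"
  "(\<forall>P\<in>orb v. pt_typeIII q P) \<longleftrightarrow> pt_typeIII q (pt v)"
  using pt_in_orb[of v] by (auto simp: orb_eq pt_type_tw)

text \<open>If v = c * \<open>phi_vec q v\<close>, then going once around the three coordinates
  gives x = \<open>nrm c\<close> * x. Hence c has norm 1, is \<open>fr t / t\<close> by Hilbert 90,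
  and scaling v by t turns it into a vector of three successive conjugates.\<close>

lemma fixed_iff:
  assumes "v \<noteq> (0, 0, 0)"
  shows "pt (phi_vec q v) = pt v \<longleftrightarrow> pt v \<in> orb (1, 1, 1)"
proof
  obtain x y z where v [simp]: "v = (x, y, z)"
    by (cases v)
  assume "pt (phi_vec q v) = pt v"
  then obtain c where c: "c \<noteq> 0" "v = smul c (phi_vec q v)"
    using pt_eq_iff[of v "phi_vec q v"] by auto
  have eqs: "x = c * fr z" "y = c * fr x" "z = c * fr y"
    using c(2) unfolding v phi_vec_simp smul_simp prod.inject by blast+
  have z: "z = c * fr (c * fr x)"
    by (simp only: flip: eqs)
  have x: "x \<noteq> 0"
  proof
    assume "x = 0"
    with eqs(2) have "y = 0" by simp
    with eqs(3) have "z = 0" by simp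
    show False
      using assms \<open>x = 0\<close> \<open>y = 0\<close> \<open>z = 0\<close> by simp
  qed
  have "x = nrm c * x"
  proof -
    have "x = c * fr (c * fr (c * fr x))"
      by (simp only: flip: eqs)
    also have "\<dots> = nrm c * x"
      by (simp add: nrm_def)
    finally show ?thesis .
  qed
  then have "nrm c = 1"
    using x by simp
  then obtain t where t: "t \<noteq> 0" "c = fr t / t"
    using hilbert_90 by blast
  have "v = smul (1 / t) (tw (t * x) (1, 1, 1))"
    unfolding v by (subst z, subst eqs(2)) (use t in simp)
  then have "pt v = pt (tw (t * x) (1, 1, 1))"
    using t by (metis divide_eq_0_iff one_neq_zero pt_smul)
  then show "pt v \<in> orb (1, 1, 1)"
    using t x unfolding orb_eq by (intro image_eqI[of _ _ "t * x"]) simp_all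
next
  assume "pt v \<in> orb (1, 1, 1)"
  then obtain t where t: "t \<noteq> 0" "pt v = pt (tw t (1, 1, 1))"
    by (auto simp: orb_eq)
  have "pt_typeI q (pt (1, 1, 1 :: 'a))"
    unfolding pt_typeI_iff by simp
  then have "pt_typeI q (pt v)"
    using t pt_type_tw(1) by metis
  then show "pt (phi_vec q v) = pt v"
    unfolding pt_typeI_iff .
qed

text \<open>The determinant whose rows are the conjugates of t, of s and of r, expanded along the
  first row. The three terms are conjugate to each other, hence the trace.\<close>

definition tri :: "'a \<Rightarrow> 'a \<Rightarrow> 'a \<Rightarrow> 'a" where
  "tri t s r = tr (t * (fr s * fr (fr r) - fr (fr s) * fr r))"

lemma collinear3_tw:
  assumes "nz v"
  shows "collinear3 (pt (tw t v)) (pt (tw s v)) (pt (tw r v)) \<longleftrightarrow> tri t s r = 0"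
proof -
  obtain x y z where [simp]: "v = (x, y, z)"
    by (cases v)
  have "dot (tw t v) (cross (tw s v) (tw r v)) = x * y * z * tri t s r"
    by (simp add: tri_def tr_def algebra_simps)
  then show ?thesis
    using assms by (simp add: collinear3_pt)
qed

lemma noncollinear3_distinct:
  assumes "\<not> collinear3 (pt u) (pt v) (pt w)"
  shows "pt u \<noteq> pt v" "pt u \<noteq> pt w" "pt v \<noteq> pt w"
proof -
  have "dot u (cross v w) = 0" if "v = smul c w" for c
    using that by (cases u) (simp add: cross_smul_self)
  moreover have "dot u (cross v w) = 0" if "u = smul c w" for c
    using that dot_cross(2)[of w v] dot_smul[of c w 1 "cross v w"] by simp
  moreover have "dot u (cross v w) = 0" if "u = smul c v" for c
    using that dot_cross(1)[of v w] dot_smul[of c v 1 "cross v w"] by simp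
  ultimately show "pt u \<noteq> pt v" "pt u \<noteq> pt w" "pt v \<noteq> pt w"
    using assms unfolding collinear3_pt pt_eq_iff by blast+
qed

lemma ex_tri_neq_0: "\<exists>t. tri t 1 s \<noteq> 0" if "fr s \<noteq> s"
proof -
  let ?a = "fr 1 * fr (fr s) - fr (fr 1) * fr s"
  have a: "?a \<noteq> 0"
    using that fr_eq_iff[of "fr s" s] by (simp del: fr_eq_iff)
  have "card {t. t \<noteq> 0 \<and> tr (t * ?a) = 0} < card (UNIV - {0 :: 'a})"
  proof -
    have "q ^ 2 < q ^ 3"
      using q_ge_2 by (intro power_strict_increasing) auto
    moreover have "q ^ 2 > 0"
      using q_ge_2 by simp
    ultimately have "q ^ 2 - 1 < q ^ 3 - 1"
      by linarith
    then show ?thesis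
      unfolding card_perp_units[OF a] by (simp add: card_field)
  qed
  then have "\<not> UNIV - {0} \<subseteq> {t. t \<noteq> 0 \<and> tr (t * ?a) = 0}"
    using card_mono[of "{t. t \<noteq> 0 \<and> tr (t * ?a) = 0}" "UNIV - {0}"] by (meson finite leD)
  then show ?thesis
    by (auto simp: tri_def)
qed

lemma ex_not_fixed: "\<exists>s. fr s \<noteq> s"
proof (rule ccontr)
  assume "\<not> (\<exists>s. fr s \<noteq> s)"
  then have "{x. fr x = x} = UNIV"
    by auto
  then have "q = q ^ 3"
    using card_fixed card_field by simp
  moreover have "q ^ 1 < q ^ 3"
    using q_ge_2 by (intro power_strict_increasing) auto
  ultimately show False
    by simp
qed

lemma Fq_plane_orb:
  assumes nz: "nz v"
  shows "Fq_plane q (orb v)"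
  unfolding Fq_plane_def
proof (intro conjI ballI impI)
  have v0: "v \<noteq> (0, 0, 0)" "recip v \<noteq> (0, 0, 0)"
    using nz by (auto simp: two_nz_imp_nonzero nz_imp_two_nz)
  show "orb v \<subseteq> Pts"
    using v0 by (auto simp: orb_eq tw_eq_0_iff)
  show "\<exists>A\<in>orb v. \<exists>B\<in>orb v. \<exists>C\<in>orb v. \<exists>D\<in>orb v. distinct [A, B, C, D] \<and>
      \<not> collinear3 A B C \<and> \<not> collinear3 A B D \<and> \<not> collinear3 A C D \<and> \<not> collinear3 B C D"
  proof -
    obtain s where "fr s \<noteq> s"
      using ex_not_fixed by blast
    then obtain t where t: "tri t 1 s \<noteq> 0"
      using ex_tri_neq_0 by blast
    \<comment> \<open>t, 1 and s are a basis over F_q. Adding their sum gives the standard frame: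
      every determinant of three of the four is that of the basis up to sign.\<close>
    define u where "u = t + 1 + s"
    have tris: "tri t 1 u = tri t 1 s" "tri t s u = - tri t 1 s" "tri 1 s u = tri t 1 s"
      by (simp_all add: tri_def tr_def u_def algebra_simps)
    have nc: "\<not> collinear3 (pt (tw t v)) (pt (tw 1 v)) (pt (tw s v))"
      "\<not> collinear3 (pt (tw t v)) (pt (tw 1 v)) (pt (tw u v))"
      "\<not> collinear3 (pt (tw t v)) (pt (tw s v)) (pt (tw u v))"
      "\<not> collinear3 (pt (tw 1 v)) (pt (tw s v)) (pt (tw u v))"
      unfolding collinear3_tw[OF nz] tris using t by simp_all
    have "t \<noteq> 0" "s \<noteq> 0"
      using t by (auto simp: tri_def tr_def)
    moreover have "u \<noteq> 0"
      using t tris(1) by (auto simp: tri_def tr_def)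
    ultimately have "pt (tw t v) \<in> orb v" "pt (tw 1 v) \<in> orb v" "pt (tw s v) \<in> orb v"
      "pt (tw u v) \<in> orb v"
      unfolding orb_eq by (intro imageI; simp)+
    moreover have "distinct [pt (tw t v), pt (tw 1 v), pt (tw s v), pt (tw u v)]"
      using noncollinear3_distinct[OF nc(1)] noncollinear3_distinct[OF nc(2)]
        noncollinear3_distinct[OF nc(3)] by simp
    ultimately show ?thesis
      using nc by blast
  qed
  fix P Q assume "P \<in> orb v" "Q \<in> orb v" "P \<noteq> Q"
  then obtain t s where ts: "P = pt (tw t v)" "Q = pt (tw s v)" "t \<noteq> 0" "s \<noteq> 0"
    by (auto simp: orb_eq)
  let ?a = "fr t * fr (fr s) - fr (fr t) * fr s"
  have a: "?a \<noteq> 0"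
    using pt_tw_neq_imp[OF nz_imp_two_nz[OF nz]] ts \<open>P \<noteq> Q\<close> by blast
  then show "\<exists>L\<in>Lns. inc P L \<and> inc Q L \<and> card (on_line L \<inter> orb v) = q + 1"
    using ts v0 tr_cross(1)[of t s] tr_cross(2)[of s t]
    by (intro bexI[of _ "pt (tw ?a (recip v))"] conjI card_on_line_Int_orb[OF nz a])
      (simp_all only: inc_pt dot_tw_recip[OF nz] Lns_eq_Pts pt_in_Pts tw_eq_0_iff simp_thms)
next
  fix L M assume L: "L \<in> Lns" and M: "M \<in> Lns"
    and LM: "L \<noteq> M \<and> 2 \<le> card (on_line L \<inter> orb v) \<and> 2 \<le> card (on_line M \<inter> orb v)"
  obtain a where a: "a \<noteq> 0" "L = pt (tw a (recip v))"
    using line_of_two_points[OF nz L] LM by (metis two_points_on_line)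
  obtain b where b: "b \<noteq> 0" "M = pt (tw b (recip v))"
    using line_of_two_points[OF nz M] LM by (metis two_points_on_line)
  \<comment> \<open>The parameter of the meet is given by the formula for the join, since the trace
    form treats points and lines alike.\<close>
  let ?t = "fr a * fr (fr b) - fr (fr a) * fr b"
  have "?t \<noteq> 0"
    using pt_tw_neq_imp[of "recip v" a b] nz_imp_two_nz[of "recip v"] nz a b LM by simp
  then show "\<exists>P\<in>orb v. inc P L \<and> inc P M"
    using a b tr_cross(1)[of a b] tr_cross(2)[of b a]
    by (intro bexI[of _ "pt (tw ?t v)"] conjI)
      (simp_all add: dot_tw_recip[OF nz] orb_eq mult.commute)
qed

text \<open>The group is diagonal, so a vanishing coordinate vanishes on the whole orbit, which then
  lies on a side of the triangle and has no three non-collinear points.\<close>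

lemma not_Fq_plane_orb:
  assumes "\<not> nz v"
  shows "\<not> Fq_plane q (orb v)"
proof
  assume plane: "Fq_plane q (orb v)"
  obtain A B C where ABC: "A \<in> orb v" "B \<in> orb v" "C \<in> orb v" "\<not> collinear3 A B C"
    using plane[unfolded Fq_plane_def, THEN conjunct2, THEN conjunct1] by (elim bexE conjE)
  obtain n where n: "n \<noteq> (0, 0, 0)" "\<And>t. dot (tw t v) n = 0"
  proof -
    obtain x y z where v: "v = (x, y, z)"
      by (cases v)
    then consider "x = 0" | "y = 0" | "z = 0"
      using assms by auto
    then show thesis
      using that[of "(1, 0, 0)"] that[of "(0, 1, 0)"] that[of "(0, 0, 1)"] v by cases auto
  qed
  have "inc P (pt n)" if "P \<in> orb v" for P
    using that n by (auto simp: orb_eq)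
  then have "collinear3 A B C"
    using ABC n unfolding collinear3_def Lns_eq_Pts by (meson pt_in_Pts)
  then show False
    using ABC by blast
qed

section \<open>Counting the orbits that are planes\<close>

lemma nz_pt_cong: "pt v = pt w \<Longrightarrow> nz v = nz w"
  by (auto simp: pt_eq_iff nz_smul)

lemma nz_orb_cong: "orb v = orb w \<Longrightarrow> nz v = nz w"
  using nz_pt_cong nz_tw by (metis orb_eq_iff)

lemma orb_smul: "c \<noteq> 0 \<Longrightarrow> orb (smul c v) = orb v"
  by (simp add: pt_smul)

lemma orb_normalize: "x \<noteq> 0 \<Longrightarrow> orb (x, y, z) = orb (1, y / x, z / x)"
  using orb_smul[of x "(1, y / x, z / x)"] by simp

text \<open>Normalised to first coordinate 1, the group multiplies y by \<open>fr t / t\<close> and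
  z by \<open>fr (fr t) / t\<close>. These factors cancel in both expressions. Conversely, equal
  norms give t by Hilbert 90, and the second invariant then determines z.\<close>

lemma orb_eq_iff_invariants:
  assumes "y \<noteq> 0" "z \<noteq> 0" "y' \<noteq> 0" "z' \<noteq> 0"
  shows "orb (1, y, z) = orb (1, y', z') \<longleftrightarrow> nrm y = nrm y' \<and> fr y * fr (fr z) = fr y' * fr (fr z')"
proof
  assume "orb (1, y, z) = orb (1, y', z')"
  then obtain t where t: "t \<noteq> 0" "pt (1, y, z) = pt (t, fr t * y', fr (fr t) * z')"
    by (auto simp: orb_eq_iff)
  then obtain c where c: "1 = c * t" "y = c * (fr t * y')" "z = c * (fr (fr t) * z')"
    by (auto simp: pt_eq_iff)
  have "c = 1 / t"
    using c(1) t(1) by (simp add: field_simps)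
  then have yz: "y = fr t * y' / t" "z = fr (fr t) * z' / t"
    using c by simp_all
  show "nrm y = nrm y' \<and> fr y * fr (fr z) = fr y' * fr (fr z')"
    unfolding yz using t(1) by (simp add: nrm_def)
next
  assume *: "nrm y = nrm y' \<and> fr y * fr (fr z) = fr y' * fr (fr z')"
  then have "nrm (y / y') = 1"
    using assms by (simp add: nrm_divide)
  then obtain t where t: "t \<noteq> 0" "y / y' = fr t / t"
    using hilbert_90 by blast
  have "fr (fr y * fr (fr z)) = fr (fr y' * fr (fr z'))"
    using * by (simp only:)
  then have "fr (fr (y / y')) * (z / z') = 1"
    using assms by simp
  then have "z = fr (fr t) / t * z'"
    unfolding t(2) using assms t(1) by (simp add: field_simps)
  moreover have "y = fr t / t * y'"
    using t assms by (simp add: field_simps)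
  ultimately have "(1, y, z) = smul (1 / t) (tw t (1, y', z'))"
    using t(1) by simp
  then show "orb (1, y, z) = orb (1, y', z')"
    using t(1) by (metis divide_eq_0_iff orb_smul orb_tw zero_neq_one)
qed

definition plane_orbs :: "'a vec3 set set set" where
  "plane_orbs = {orb v | v. nz v}"

lemma plane_orbsE:
  assumes "X \<in> plane_orbs"
  obtains v where "X = orb v" "nz v"
  using assms unfolding plane_orbs_def by blast

lemma orb_in_plane_orbs [simp]: "orb v \<in> plane_orbs \<longleftrightarrow> nz v"
  unfolding plane_orbs_def using nz_orb_cong by blast

lemma card_plane_orbs: "card plane_orbs = (q ^ 3 - 1) * (q - 1)"
proof -
  let ?U = "UNIV - {0 :: 'a}"
  let ?f = "\<lambda>(y, z). orb (1, y, z)" and ?g = "\<lambda>(y, z). (nrm y, fr y * fr (fr z))"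
  have "plane_orbs = ?f ` (?U \<times> ?U)"
  proof (intro equalityI subsetI)
    fix X assume "X \<in> plane_orbs"
    then obtain v where v: "X = orb v" "nz v"
      by (elim plane_orbsE)
    obtain x y z where [simp]: "v = (x, y, z)"
      by (cases v)
    have "X = ?f (y / x, z / x)"
      using v orb_normalize[of x y z]
      by (simp only: \<open>v = (x, y, z)\<close> nz_simp prod.case not_False_eq_True)
    then show "X \<in> ?f ` (?U \<times> ?U)"
      by (rule image_eqI) (use v in simp)
  next
    fix X assume "X \<in> ?f ` (?U \<times> ?U)"
    then obtain y z where "X = orb (1, y, z)" "y \<noteq> 0" "z \<noteq> 0"
      by (elim imageE SigmaE) simp
    then show "X \<in> plane_orbs"
      by simp
  qed
  also have "card \<dots> = card (?g ` (?U \<times> ?U))"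
    by (rule card_image_cong_fibres, elim SigmaE) (simp add: orb_eq_iff_invariants)
  \<comment> \<open>The invariants take all values independently: y is chosen with norm k, and then
    the second invariant is solved for z.\<close>
  also have "?g ` (?U \<times> ?U) = {k. k \<noteq> 0 \<and> fr k = k} \<times> ?U"
  proof (intro equalityI subsetI)
    fix p assume "p \<in> {k. k \<noteq> 0 \<and> fr k = k} \<times> ?U"
    then obtain k a where p: "p = (k, a)" "k \<noteq> 0" "fr k = k" "a \<noteq> 0"
      by auto
    then obtain y where y: "y \<noteq> 0" "k = nrm y"
      using fr_fixed_iff_nrm by blast
    have "p = ?g (y, fr (a / fr y))"
      using p y by simp
    then show "p \<in> ?g ` (?U \<times> ?U)"
      using p y by (intro image_eqI[of _ _ "(y, fr (a / fr y))"]) auto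
  qed (auto simp: fr_nrm)
  also have "card \<dots> = (q ^ 3 - 1) * (q - 1)"
    by (simp add: card_cartesian_product card_fixed_units card_field)
  finally show ?thesis .
qed

section \<open>Planes with Type II points, counted on the line [1, 1, 1]\<close>

definition plane_orbs_II :: "'a vec3 set set set" where
  "plane_orbs_II = {X \<in> plane_orbs. \<forall>P\<in>X. pt_typeII q P}"

text \<open>Parametrises the line [1, 1, 1] except for its point (0, 1, -1). That point is on a side
  of the triangle, as are those for y = 0 and y = -1, so q^3 - 2 values of y give the points off the
  triangle.\<close>

definition sum0 :: "'a \<Rightarrow> 'a vec3" where
  "sum0 y = (1, y, - 1 - y)"

lemma sum0_perp: "dot (sum0 y) (1, 1, 1) = 0"
  by (simp add: sum0_def)

lemma sum0_nonzero: "sum0 y \<noteq> (0, 0, 0)"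
  by (simp add: sum0_def)

lemma pt_sum0_eq_iff: "pt (sum0 y) = pt (sum0 y') \<longleftrightarrow> y = y'"
  by (auto simp: pt_eq_iff sum0_def)

lemma nz_sum0: "nz (sum0 y) \<longleftrightarrow> y \<noteq> 0 \<and> y \<noteq> - 1"
proof -
  have "- 1 - y = 0 \<longleftrightarrow> y = - 1"
    by (metis diff_eq_eq add_0 eq_commute)
  then show ?thesis
    by (simp add: sum0_def)
qed

text \<open>The line [1, 1, 1] is fixed by \<open>phi\<close>, so it contains all three images of
  each of its points.\<close>

lemma phi_det_sum0: "phi_det (sum0 y) = 0"
proof -
  have "phi_vec q (1, 1, 1) = (1, 1, 1 :: 'a)"
    by simp
  then have "dot (phi_vec q (sum0 y)) (1, 1, 1) = 0"
    "dot (phi_vec q (phi_vec q (sum0 y))) (1, 1, 1) = 0"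
    using dot_phi_vec[of "sum0 y" "(1, 1, 1)"] dot_phi_vec[of "phi_vec q (sum0 y)" "(1, 1, 1)"]
    by (simp_all add: sum0_perp)
  then have "\<exists>n. n \<noteq> (0, 0, 0) \<and> dot (sum0 y) n = 0 \<and> dot (phi_vec q (sum0 y)) n = 0 \<and>
      dot (phi_vec q (phi_vec q (sum0 y))) n = 0"
    using sum0_perp by (intro exI[of _ "(1, 1, 1)"]) simp
  then show ?thesis
    unfolding ex_perp3_iff phi_det_def .
qed

lemma card_fixed_sum0: "card {y. pt (sum0 y) \<in> orb (1, 1, 1)} = q + 1"
proof -
  have "(\<lambda>y. pt (sum0 y)) ` {y. pt (sum0 y) \<in> orb (1, 1, 1)} = on_line (pt (1, 1, 1)) \<inter> orb (1, 1, 1)"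
  proof (intro equalityI subsetI)
    fix P assume "P \<in> on_line (pt (1, 1, 1)) \<inter> orb (1, 1, 1)"
    then have P: "P \<in> orb (1, 1, 1)" "inc P (pt (1, 1, 1))"
      by (auto simp: on_line_def)
    then obtain t where t: "t \<noteq> 0" "P = pt (t, fr t, fr (fr t))"
      by (auto simp: orb_eq)
    then have t0: "t + fr t + fr (fr t) = 0"
      using P by simp
    have "fr (fr t) = - t - fr t"
      using t0 by (metis add.commute add_diff_cancel_left' diff_0 diff_minus_eq_add)
    then have "(t, fr t, fr (fr t)) = smul t (sum0 (fr t / t))"
      using t(1) by (simp add: sum0_def algebra_simps)
    then have "P = pt (sum0 (fr t / t))"
      using t pt_smul by metis
    then show "P \<in> (\<lambda>y. pt (sum0 y)) ` {y. pt (sum0 y) \<in> orb (1, 1, 1)}"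
      using P(1) by blast
  next
    fix P assume "P \<in> (\<lambda>y. pt (sum0 y)) ` {y. pt (sum0 y) \<in> orb (1, 1, 1)}"
    then show "P \<in> on_line (pt (1, 1, 1)) \<inter> orb (1, 1, 1)"
      by (auto simp: on_line_def sum0_nonzero sum0_perp)
  qed
  moreover have "card ((\<lambda>y. pt (sum0 y)) ` {y. pt (sum0 y) \<in> orb (1, 1, 1)}) =
      card {y. pt (sum0 y) \<in> orb (1, 1, 1)}"
    by (intro card_image inj_onI) (simp add: pt_sum0_eq_iff)
  ultimately show ?thesis
    using card_on_line_Int_orb[of "(1, 1, 1)" 1] by simp
qed

text \<open>By collinearity the line ?n through v and its image contains the second image too, so ?n
  is fixed and equals \<open>tw a (1, 1, 1)\<close> up to a scalar. Moving the diagonal factor from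
  the line to the point places \<open>tw a v\<close> on [1, 1, 1].\<close>

lemma orb_typeII_meets_sum0:
  assumes "nz v" "pt_typeII q (pt v)"
  shows "\<exists>y. orb v = orb (sum0 y)"
proof -
  let ?n = "cross v (phi_vec q v)"
  have v: "v \<noteq> (0, 0, 0)" "pt (phi_vec q v) \<noteq> pt v" "phi_det v = 0"
    using assms by (auto simp: pt_typeII_iff two_nz_imp_nonzero nz_imp_two_nz)
  then have n: "?n \<noteq> (0, 0, 0)"
    using pt_eq_iff_cross[of v "phi_vec q v"] by auto
  have "dot v (phi_vec q ?n) = 0"
    using v(3) by (simp add: phi_det_def flip: cross_phi_vec)
  moreover have "dot (phi_vec q v) (phi_vec q ?n) = 0"
    by (simp add: dot_phi_vec dot_cross)
  ultimately obtain c where c: "phi_vec q ?n = smul c ?n"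
    using perp_imp_smul_cross n by blast
  then have "c \<noteq> 0"
    using n by (metis phi_vec_eq_0_iff smul_eq_0_iff)
  then have "pt (phi_vec q ?n) = pt ?n"
    using c by (simp add: pt_smul)
  then have "pt ?n \<in> orb (1, 1, 1)"
    using fixed_iff[OF n] by simp
  then obtain a where a: "a \<noteq> 0" "pt ?n = pt (tw a (1, 1, 1))"
    by (auto simp: orb_eq)
  have "inc (pt v) (pt ?n)"
    by (simp add: dot_cross)
  then have perp: "dot v (tw a (1, 1, 1)) = 0"
    unfolding a by (simp only: inc_pt)
  obtain x y z where xyz: "tw a v = (x, y, z)"
    by (cases "tw a v")
  have "x + y + z = 0"
    using perp xyz by (cases v) (auto simp: mult.commute)
  moreover have "x \<noteq> 0"
    using nz_tw[OF a(1), of v] assms xyz by simp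
  ultimately have "z / x = - 1 - y / x"
    by (simp add: field_simps) (metis add.commute add_diff_cancel_left' diff_0)
  then have "orb (x, y, z) = orb (sum0 (y / x))"
    using orb_normalize[OF \<open>x \<noteq> 0\<close>, of y z] by (simp add: sum0_def)
  then show ?thesis
    using orb_tw[OF a(1), of v] xyz by auto
qed

text \<open>The representative ?w lies on the fixed lines [1, 1, 1] and
  \<open>tw t (1, 1, 1)\<close>. If t is outside F_q, these differ and meet in a fixed point, which
  is excluded; if t is in F_q, then \<open>tw t\<close> is a scalar.\<close>

lemma orb_sum0_eq_imp_eq:
  assumes "orb (sum0 y) = orb (sum0 y')" "pt (sum0 y') \<notin> orb (1, 1, 1)"
  shows "y = y'"
proof -
  let ?w = "sum0 y'"
  obtain t where t: "t \<noteq> 0" "pt (sum0 y) = pt (tw t ?w)"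
    using assms(1) orb_eq_iff by blast
  have "inc (pt (sum0 y)) (pt (1, 1, 1))"
    by (simp add: sum0_perp)
  then have "dot (tw t ?w) (1, 1, 1) = 0"
    unfolding t by (simp only: inc_pt)
  then have perp: "dot (tw t (1, 1, 1)) ?w = 0" "dot (1, 1, 1) ?w = 0"
    by (simp_all add: sum0_def)
  have cross: "cross (1, 1, 1) (tw t (1, 1, 1)) = tw (fr (fr t) - fr t) (1, 1, 1)"
    by simp
  show ?thesis
  proof (cases "fr t = t")
    case True
    then have "tw t ?w = smul t ?w"
      by (simp add: sum0_def)
    then show ?thesis
      using t by (simp add: pt_smul pt_sum0_eq_iff)
  next
    case False
    then have a: "fr (fr t) - fr t \<noteq> 0"
      by simp
    then have "cross (1, 1, 1) (tw t (1, 1, 1)) \<noteq> (0, 0, 0)"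
      unfolding cross by (simp add: tw_eq_0_iff del: tw_simp)
    then obtain c where "?w = smul c (tw (fr (fr t) - fr t) (1, 1, 1))"
      using perp_imp_smul_cross perp cross by metis
    moreover from this have "c \<noteq> 0"
      using sum0_nonzero by (metis smul_eq_0_iff)
    ultimately have "pt ?w = pt (tw (fr (fr t) - fr t) (1, 1, 1))"
      using pt_smul by metis
    then show ?thesis
      using assms(2) a orb_eq by blast
  qed
qed

lemma card_plane_orbs_II: "int (card plane_orbs_II) = int q ^ 3 - int q - 3"
proof -
  let ?B = "{y. pt (sum0 y) \<in> orb (1, 1, 1)}"
  let ?Y = "UNIV - {0, - 1} - ?B"
  have "plane_orbs_II = (\<lambda>y. orb (sum0 y)) ` ?Y"
  proof (intro equalityI subsetI)
    fix X assume "X \<in> plane_orbs_II"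
    then obtain v where v: "X = orb v" "nz v" "pt_typeII q (pt v)"
      unfolding plane_orbs_II_def by (auto simp: orb_type elim!: plane_orbsE)
    then obtain y where y: "orb v = orb (sum0 y)"
      using orb_typeII_meets_sum0 by blast
    then have "nz (sum0 y)"
      using nz_orb_cong v by blast
    moreover have "pt_typeII q (pt (sum0 y))"
      using v y orb_type(2) by metis
    then have "pt (sum0 y) \<notin> orb (1, 1, 1)"
      using fixed_iff[OF sum0_nonzero, of y] by (auto simp: pt_typeII_iff)
    ultimately show "X \<in> (\<lambda>y. orb (sum0 y)) ` ?Y"
      using v y by (auto simp: nz_sum0)
  next
    fix X assume "X \<in> (\<lambda>y. orb (sum0 y)) ` ?Y"
    then obtain y where "X = orb (sum0 y)" "nz (sum0 y)" "pt (sum0 y) \<notin> orb (1, 1, 1)"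
      by (auto simp: nz_sum0)
    then show "X \<in> plane_orbs_II"
      using fixed_iff[OF sum0_nonzero, of y] phi_det_sum0
      by (simp add: plane_orbs_II_def orb_type pt_typeII_iff)
  qed
  moreover have "inj_on (\<lambda>y. orb (sum0 y)) ?Y"
    using orb_sum0_eq_imp_eq by (intro inj_onI) auto
  ultimately have c: "card plane_orbs_II = card ?Y"
    by (simp add: card_image)
  \<comment> \<open>Fixed points have no zero coordinate, so the two removals do not overlap and the
    count is q^3 - 2 - (q + 1).\<close>
  have sub: "?B \<subseteq> UNIV - {0, - 1}"
  proof
    fix y assume "y \<in> ?B"
    then obtain t where "t \<noteq> 0" "pt (sum0 y) = pt (tw t (1, 1, 1))"
      by (auto simp: orb_eq)
    then have "nz (sum0 y)"
      using nz_pt_cong[of "sum0 y" "tw t (1, 1, 1)"] by simp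
    then show "y \<in> UNIV - {0, - 1}"
      by (simp add: nz_sum0)
  qed
  have "card ?Y = card (UNIV - {0, - 1 :: 'a}) - card ?B"
    using sub by (intro card_Diff_subset) auto
  moreover have "card ?B \<le> card (UNIV - {0, - 1 :: 'a})"
    using sub by (intro card_mono) auto
  moreover have "card (UNIV - {0, - 1 :: 'a}) = q ^ 3 - 2"
    by (simp add: card_Diff_subset card_field)
  moreover have "q ^ 3 \<ge> 2"
    using power_increasing[of 1 3 q] q_ge_2 by simp
  ultimately show ?thesis
    using c card_fixed_sum0 by (simp add: of_nat_diff flip: of_nat_power)
qed

section \<open>Duality, and the classification of planes by two determinants\<close>

lemma recip_orb_cong: "nz v \<Longrightarrow> nz w \<Longrightarrow> orb v = orb w \<Longrightarrow> orb (recip v) = orb (recip w)"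
  by (metis plane_lines_orb)

lemma fixed_orb_iff:
  assumes "nz v"
  shows "pt (phi_vec q v) = pt v \<longleftrightarrow> orb v = orb (1, 1, 1)"
  using fixed_iff[of v] assms orb_eqI pt_in_orb nz_imp_two_nz two_nz_imp_nonzero by metis

lemma fixed_recip_iff:
  assumes "nz v"
  shows "pt (phi_vec q (recip v)) = pt (recip v) \<longleftrightarrow> pt (phi_vec q v) = pt v"
proof -
  have "orb (recip v) = orb (1, 1, 1)" if "nz v" "orb v = orb (1, 1, 1)" for v
    using recip_orb_cong[of v "(1, 1, 1)"] that by simp
  from this[of v] this[of "recip v"] show ?thesis
    using assms by (auto simp: fixed_orb_iff simp del: split_paired_All)
qed

text \<open>Put \<open>A = x * fr y * fr (fr z)\<close>. The two determinant conditions say that the conjugates of \<open>A\<close>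
  and the norms of \<open>x\<close>, \<open>y\<close>, \<open>z\<close> have the same elementary symmetric functions, so \<open>A\<close> is one of
  these norms, hence fixed by \<open>fr\<close>, hence equal to all of them.\<close>

lemma phi_det_recip_imp_fixed:
  assumes "nz v" "phi_det v = 0" "phi_det (recip v) = 0"
  shows "orb v = orb (1, 1, 1)"
proof -
  obtain x y z where v: "v = (x, y, z)"
    by (cases v)
  then have nz: "x \<noteq> 0" "y \<noteq> 0" "z \<noteq> 0"
    using assms by simp_all
  define A where "A = x * fr y * fr (fr z)"
  define X Y Z where "X = nrm x" and "Y = nrm y" and "Z = nrm z"
  have nz': "A \<noteq> 0" "X \<noteq> 0" "Y \<noteq> 0" "Z \<noteq> 0"
    using nz by (simp_all add: A_def X_def Y_def Z_def)
  have det: "phi_det (x, y, z) = nrm x + nrm y + nrm z - tr (x * fr y * fr (fr z))" for x y z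
    by (simp add: phi_det_def nrm_def tr_def algebra_simps)
  have e1: "A + fr A + fr (fr A) = X + Y + Z"
    using assms(2) by (simp add: v det A_def X_def Y_def Z_def tr_def)
  have e3: "A * fr A * fr (fr A) = X * Y * Z"
    by (simp add: A_def X_def Y_def Z_def nrm_def mult_ac)
  have "1 / A + 1 / fr A + 1 / fr (fr A) = 1 / X + 1 / Y + 1 / Z"
    using assms(3) by (simp add: v det A_def X_def Y_def Z_def tr_def nrm_def)
  then have "A * fr A * fr (fr A) * (1 / A + 1 / fr A + 1 / fr (fr A)) =
      X * Y * Z * (1 / X + 1 / Y + 1 / Z)"
    by (simp only: e3)
  moreover have "A * fr A * fr (fr A) * (1 / A + 1 / fr A + 1 / fr (fr A)) =
      fr A * fr (fr A) + A * fr (fr A) + A * fr A"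
    using nz' by (simp add: field_simps)
  moreover have "X * Y * Z * (1 / X + 1 / Y + 1 / Z) = Y * Z + X * Z + X * Y"
    using nz' by (simp add: field_simps)
  ultimately have e2: "fr A * fr (fr A) + A * fr (fr A) + A * fr A = Y * Z + X * Z + X * Y"
    by simp
  have roots: "(u - A) * (u - fr A) * (u - fr (fr A)) = (u - X) * (u - Y) * (u - Z)" for u
  proof -
    have "(u - A) * (u - fr A) * (u - fr (fr A)) =
        u ^ 3 - u ^ 2 * (A + fr A + fr (fr A))
        + u * (fr A * fr (fr A) + A * fr (fr A) + A * fr A) - A * fr A * fr (fr A)"
      by (simp add: algebra_simps power2_eq_square power3_eq_cube)
    also have "\<dots> = (u - X) * (u - Y) * (u - Z)"
      unfolding e1 e2 e3 by (simp add: algebra_simps power2_eq_square power3_eq_cube)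
    finally show ?thesis .
  qed
  have "A = X \<or> A = Y \<or> A = Z"
    using roots[of A] by simp
  then have "fr A = A"
    by (auto simp: X_def Y_def Z_def fr_nrm)
  \<comment> \<open>The left side of \<open>roots\<close> is now (u - A)^3, and it vanishes at X, Y
    and Z.\<close>
  then have "X = A" "Y = A" "Z = A"
    using roots[of X] roots[of Y] roots[of Z] by simp_all
  \<comment> \<open>X = Y is the first equation; the second is A = X divided by
    \<open>nrm x\<close>. These are the two orbit invariants, with the values they have at (1, 1,
    1).\<close>
  then have "nrm (y / x) = 1" "fr (y / x) * fr (fr (z / x)) = 1"
    using nz nz' by (simp_all add: X_def Y_def nrm_divide)
      (simp add: A_def nrm_def field_simps)
  then have "orb (1, y / x, z / x) = orb (1, 1, 1)"
    using orb_eq_iff_invariants[of "y / x" "z / x" 1 1] nz by (simp add: nrm_def)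
  then show ?thesis
    using orb_normalize[OF nz(1)] v by metis
qed

definition plane_orbs_dual_II :: "'a vec3 set set set" where
  "plane_orbs_dual_II = {X \<in> plane_orbs. plane_lines q X \<in> plane_orbs_II}"

lemma card_plane_orbs_dual_II: "card plane_orbs_dual_II = card plane_orbs_II"
proof (rule bij_betw_same_card[of "plane_lines q"], rule bij_betw_byWitness[where f' = "plane_lines q"])
  have inv: "plane_lines q (plane_lines q X) = X \<and> plane_lines q X \<in> plane_orbs"
    if "X \<in> plane_orbs" for X
    using that by (elim plane_orbsE) (simp add: plane_lines_orb)
  then show "\<forall>X\<in>plane_orbs_dual_II. plane_lines q (plane_lines q X) = X"
    "\<forall>X\<in>plane_orbs_II. plane_lines q (plane_lines q X) = X"
    unfolding plane_orbs_dual_II_def plane_orbs_II_def by blast+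
  show "plane_lines q ` plane_orbs_dual_II \<subseteq> plane_orbs_II"
    unfolding plane_orbs_dual_II_def by blast
  show "plane_lines q ` plane_orbs_II \<subseteq> plane_orbs_dual_II"
  proof
    fix Y assume "Y \<in> plane_lines q ` plane_orbs_II"
    then obtain X where X: "Y = plane_lines q X" "X \<in> plane_orbs_II"
      by blast
    then have "X \<in> plane_orbs"
      unfolding plane_orbs_II_def by blast
    then show "Y \<in> plane_orbs_dual_II"
      unfolding plane_orbs_dual_II_def using X inv by simp
  qed
qed

lemma orb_in_plane_orbs_II: "orb v \<in> plane_orbs_II \<longleftrightarrow> nz v \<and> pt_typeII q (pt v)"
  by (simp add: plane_orbs_II_def orb_type)

lemma orb_in_plane_orbs_dual_II: "orb v \<in> plane_orbs_dual_II \<longleftrightarrow> nz v \<and> pt_typeII q (pt (recip v))"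
  by (auto simp: plane_orbs_dual_II_def plane_lines_orb orb_in_plane_orbs_II)

lemma orbST_E:
  assumes "X \<in> orbST q"
  obtains v :: "'a vec3" where "X = orb v" "v \<noteq> (0, 0, 0)"
  using assms unfolding orbST_def by (blast elim: PtsE)

lemma orb_in_orbST: "v \<noteq> (0, 0, 0) \<Longrightarrow> orb v \<in> orbST q"
  unfolding orbST_def using pt_in_Pts by blast

lemma Fq_plane_orbs_eq: "{X \<in> orbST q. Fq_plane q X \<and> R X} = {X \<in> plane_orbs. R X}"
proof (intro equalityI subsetI)
  fix X assume "X \<in> {X \<in> orbST q. Fq_plane q X \<and> R X}"
  then obtain v where "X = orb v" "Fq_plane q X" "R X"
    by (blast elim: orbST_E)
  then show "X \<in> {X \<in> plane_orbs. R X}"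
    using not_Fq_plane_orb[of v] by auto
next
  fix X assume "X \<in> {X \<in> plane_orbs. R X}"
  then obtain v where "X = orb v" "nz v" "R X"
    by (blast elim: plane_orbsE)
  then show "X \<in> {X \<in> orbST q. Fq_plane q X \<and> R X}"
    using Fq_plane_orb orb_in_orbST nz_imp_two_nz two_nz_imp_nonzero by simp
qed

lemma plane_orbs_cong:
  assumes "\<And>v. nz v \<Longrightarrow> R (orb v) \<longleftrightarrow> orb v \<in> S" "S \<subseteq> plane_orbs"
  shows "{X \<in> orbST q. Fq_plane q X \<and> R X} = S"
  unfolding Fq_plane_orbs_eq
proof (intro equalityI subsetI)
  fix X assume "X \<in> {X \<in> plane_orbs. R X}"
  then show "X \<in> S"
    using assms(1) by (blast elim: plane_orbsE)
next
  fix X assume "X \<in> S"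
  moreover from this obtain v where "X = orb v" "nz v"
    using assms(2) by (blast elim: plane_orbsE)
  ultimately show "X \<in> {X \<in> plane_orbs. R X}"
    using assms(1) by simp
qed

text \<open>The four vanishing patterns of the two determinants are the four kinds of planes; the
  pattern with neither zero is left for Type III points and lines.\<close>

lemma plane_type_cases:
  assumes "nz v"
  shows "orb v = orb (1, 1, 1) \<longleftrightarrow> phi_det v = 0 \<and> phi_det (recip v) = 0"
    and "pt_typeII q (pt v) \<longleftrightarrow> phi_det v = 0 \<and> phi_det (recip v) \<noteq> 0"
    and "pt_typeII q (pt (recip v)) \<longleftrightarrow> phi_det v \<noteq> 0 \<and> phi_det (recip v) = 0"
proof -
  have fixed: "pt (phi_vec q v) = pt v \<longleftrightarrow> orb v = orb (1, 1, 1)"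
    using fixed_orb_iff[OF assms] .
  have 1: "phi_det v = 0" "phi_det (recip v) = 0" if "orb v = orb (1, 1, 1)"
    using that fixed fixed_recip_iff[OF assms] phi_det_eq_0_if_fixed by simp_all
  then show a: "orb v = orb (1, 1, 1) \<longleftrightarrow> phi_det v = 0 \<and> phi_det (recip v) = 0"
    using phi_det_recip_imp_fixed[OF assms] by blast
  show "pt_typeII q (pt v) \<longleftrightarrow> phi_det v = 0 \<and> phi_det (recip v) \<noteq> 0"
    using a by (auto simp: pt_typeII_iff fixed)
  show "pt_typeII q (pt (recip v)) \<longleftrightarrow> phi_det v \<noteq> 0 \<and> phi_det (recip v) = 0"
    using a by (auto simp: pt_typeII_iff fixed_recip_iff[OF assms] fixed)
qed

lemma planes_typeII_III:
  "{X \<in> orbST q. Fq_plane q X \<and> (\<forall>P\<in>X. pt_typeII q P) \<and> (\<forall>L\<in>plane_lines q X. ln_typeIII q L)} =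
    plane_orbs_II"
proof (rule plane_orbs_cong)
  show "(\<forall>P\<in>orb v. pt_typeII q P) \<and> (\<forall>L\<in>plane_lines q (orb v). ln_typeIII q L) \<longleftrightarrow>
      orb v \<in> plane_orbs_II" if "nz v" for v
    using plane_type_cases[OF that] that
    by (simp add: plane_lines_orb orb_type orb_in_plane_orbs_II ln_type_eq_pt_type pt_typeIII_iff)
qed (auto simp: plane_orbs_II_def)

lemma planes_typeIII_II:
  "{X \<in> orbST q. Fq_plane q X \<and> (\<forall>P\<in>X. pt_typeIII q P) \<and> (\<forall>L\<in>plane_lines q X. ln_typeII q L)} =
    plane_orbs_dual_II"
proof (rule plane_orbs_cong)
  show "(\<forall>P\<in>orb v. pt_typeIII q P) \<and> (\<forall>L\<in>plane_lines q (orb v). ln_typeII q L) \<longleftrightarrow>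
      orb v \<in> plane_orbs_dual_II" if "nz v" for v
    using plane_type_cases[OF that] that
    by (auto simp: plane_lines_orb orb_type orb_in_plane_orbs_dual_II ln_type_eq_pt_type pt_typeIII_iff)
qed (auto simp: plane_orbs_dual_II_def)

lemma planes_typeIII_III:
  "{X \<in> orbST q. Fq_plane q X \<and> (\<forall>P\<in>X. pt_typeIII q P) \<and> (\<forall>L\<in>plane_lines q X. ln_typeIII q L)} =
    plane_orbs - {P2q q} - plane_orbs_II - plane_orbs_dual_II"
proof (rule plane_orbs_cong)
  show "(\<forall>P\<in>orb v. pt_typeIII q P) \<and> (\<forall>L\<in>plane_lines q (orb v). ln_typeIII q L) \<longleftrightarrow>
      orb v \<in> plane_orbs - {P2q q} - plane_orbs_II - plane_orbs_dual_II" if "nz v" for v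
    using plane_type_cases[OF that] that
    by (auto simp: plane_lines_orb orb_type orb_in_plane_orbs_II orb_in_plane_orbs_dual_II
        ln_type_eq_pt_type pt_typeIII_iff P2q_eq_orb)
qed auto

lemma plane_orbs_disjoint:
  "plane_orbs_II \<inter> plane_orbs_dual_II = {}"
  "P2q q \<notin> plane_orbs_II" "P2q q \<notin> plane_orbs_dual_II"
proof -
  have "X \<notin> plane_orbs_dual_II" if "X \<in> plane_orbs_II" for X
  proof -
    obtain v where v: "X = orb v" "nz v"
      using \<open>X \<in> plane_orbs_II\<close> unfolding plane_orbs_II_def by (blast elim: plane_orbsE)
    then show ?thesis
      using that plane_type_cases[OF v(2)]
      by (simp add: orb_in_plane_orbs_II orb_in_plane_orbs_dual_II)
  qed
  then show "plane_orbs_II \<inter> plane_orbs_dual_II = {}"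
    by blast
  show "P2q q \<notin> plane_orbs_II" "P2q q \<notin> plane_orbs_dual_II"
    unfolding P2q_eq_orb orb_in_plane_orbs_II orb_in_plane_orbs_dual_II
    using plane_type_cases[of "(1, 1, 1)"] by auto
qed

lemma card_planes_typeIII_III:
  "int (card (plane_orbs - {P2q q} - plane_orbs_II - plane_orbs_dual_II)) =
    int q ^ 4 - 3 * int q ^ 3 + int q + 6"
proof -
  let ?U = "{P2q q} \<union> plane_orbs_II \<union> plane_orbs_dual_II"
  \<comment> \<open>The count is (q^3 - 1) * (q - 1) - 1 - 2 * (q^3 - q - 3).\<close>
  have "?U \<subseteq> plane_orbs"
    by (auto simp: plane_orbs_II_def plane_orbs_dual_II_def P2q_eq_orb)
  have "card ?U = 1 + card plane_orbs_II + card plane_orbs_dual_II"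
    using plane_orbs_disjoint by (simp add: card_Un_disjoint Int_commute)
  moreover have "card (plane_orbs - ?U) = card plane_orbs - card ?U" "card ?U \<le> card plane_orbs"
    using \<open>?U \<subseteq> plane_orbs\<close> by (auto intro: card_Diff_subset card_mono)
  moreover have "plane_orbs - ?U = plane_orbs - {P2q q} - plane_orbs_II - plane_orbs_dual_II"
    by auto
  moreover have "int (card plane_orbs) = (int q ^ 3 - 1) * (int q - 1)"
    using q_ge_2 by (simp add: card_plane_orbs of_nat_diff)
  ultimately show ?thesis
    using card_plane_orbs_II
    by (simp add: card_plane_orbs_dual_II of_nat_diff algebra_simps power_numeral_reduce)
qed

section \<open>Orbits on the sides of the triangle\<close>

text \<open>The type is a parameter R so that the transfer between sides by \<open>phi\<close>
  serves Types II and III at once.\<close>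

definition side_orbs :: "'a vec3 \<Rightarrow> ('a vec3 set \<Rightarrow> bool) \<Rightarrow> 'a vec3 set set set" where
  "side_orbs l R = {X. sls_on q (pt l) X \<and> (\<forall>P\<in>X. R P)}"

lemma orb_vertex:
  assumes "v \<noteq> (0, 0, 0)" "\<not> two_nz v"
  shows "orb v = {pt v}"
proof -
  obtain x y z where v: "v = (x, y, z)"
    by (cases v)
  have "pt (tw t v) = pt v" if "t \<noteq> 0" for t
  proof -
    have "tw t v = smul t v \<or> tw t v = smul (fr t) v \<or> tw t v = smul (fr (fr t)) v"
      using assms v by auto
    then show ?thesis
      using that pt_smul fr_eq_0_iff by metis
  qed
  then have "orb v = (\<lambda>t. pt v) ` (UNIV - {0 :: 'a})"
    unfolding orb_eq by (intro image_cong) auto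
  then show ?thesis
    by (simp add: image_constant[of 1])
qed

text \<open>The size condition on an sls serves exactly to exclude the vertices, whose orbits are
  singletons.\<close>

lemma card_orb_iff: "v \<noteq> (0, 0, 0) \<Longrightarrow> card (orb v) = q ^ 2 + q + 1 \<longleftrightarrow> two_nz v"
  using card_orb[of v] orb_vertex[of v] q_ge_2 by (cases "two_nz v") auto

lemma orb_subset_on_line:
  assumes "v \<noteq> (0, 0, 0)"
  shows "orb v \<subseteq> on_line (pt l) \<longleftrightarrow> (\<forall>t. t \<noteq> 0 \<longrightarrow> dot (tw t v) l = 0)"
  using assms by (simp add: orb_eq image_subset_iff on_line_def tw_eq_0_iff Ball_def)

lemma sls_on_orb_iff:
  "v \<noteq> (0, 0, 0) \<Longrightarrow> sls_on q (pt l) (orb v) \<longleftrightarrow> two_nz v \<and> (\<forall>t. t \<noteq> 0 \<longrightarrow> dot (tw t v) l = 0)"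
  using card_orb_iff[of v] orb_subset_on_line[of v l] orb_in_orbST[of v] unfolding sls_on_def by blast

lemma side_orbsE:
  assumes "X \<in> side_orbs l R"
  obtains v where "X = orb v" "v \<noteq> (0, 0, 0)"
  using assms unfolding side_orbs_def sls_on_def by (blast elim: orbST_E)

lemma phi_image_orb: "phi q ` orb v = orb (phi_vec q v)"
  by (simp add: orb_eq image_image phi_vec_tw)

lemma two_nz_phi_vec [simp]: "two_nz (phi_vec q v) = two_nz (v :: 'a vec3)"
  by (cases v) auto

lemma phi_det_phi_vec: "phi_det (phi_vec q v) = fr (phi_det v)"
  unfolding phi_det_def cross_phi_vec dot_phi_vec ..

lemma pt_type_phi_vec:
  "pt_typeII q (pt (phi_vec q v)) = pt_typeII q (pt (v :: 'a vec3))"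
  "pt_typeIII q (pt (phi_vec q v)) = pt_typeIII q (pt (v :: 'a vec3))"
  by (simp_all add: pt_typeII_iff pt_typeIII_iff phi_det_phi_vec phi_pt_cancel)

lemma card_side_orbs_phi_vec_le:
  assumes "\<And>v. R (pt (phi_vec q v)) = R (pt v)"
  shows "card (side_orbs l R) \<le> card (side_orbs (phi_vec q l) R)"
proof (rule card_inj_on_le[of "\<lambda>X. phi q ` X"])
  show "inj_on (\<lambda>X. phi q ` X) (side_orbs l R)"
  proof (rule inj_onI)
    fix X Y assume "X \<in> side_orbs l R" "Y \<in> side_orbs l R" and eq: "phi q ` X = phi q ` Y"
    then obtain v w where vw: "X = orb v" "Y = orb w"
      by (elim side_orbsE) blast
    have "phi q ` phi q ` phi q ` X = phi q ` phi q ` phi q ` Y"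
      by (simp only: eq)
    then show "X = Y"
      by (simp add: vw phi_image_orb)
  qed
  show "(\<lambda>X. phi q ` X) ` side_orbs l R \<subseteq> side_orbs (phi_vec q l) R"
  proof (rule image_subsetI)
    fix X assume X: "X \<in> side_orbs l R"
    then obtain v where v: "X = orb v" "v \<noteq> (0, 0, 0)"
      by (elim side_orbsE)
    have sls: "sls_on q (pt l) (orb v)" and R: "\<And>P. P \<in> orb v \<Longrightarrow> R P"
      using X v by (auto simp: side_orbs_def)
    have "sls_on q (pt (phi_vec q l)) (orb (phi_vec q v))"
      using sls v by (simp add: sls_on_orb_iff dot_phi_vec flip: phi_vec_tw)
    moreover have "R P" if P: "P \<in> orb (phi_vec q v)" for P
    proof -
      obtain t where "t \<noteq> 0" "P = pt (phi_vec q (tw t v))"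
        using P by (auto simp: orb_eq phi_vec_tw)
      then show ?thesis
        using R[of "pt (tw t v)"] assms by (auto simp: orb_eq)
    qed
    ultimately show "phi q ` X \<in> side_orbs (phi_vec q l) R"
      by (simp add: side_orbs_def v phi_image_orb)
  qed
qed simp

text \<open>Since \<open>phi\<close> has order three, the inequalities for l and its two images form
  a cycle and are equalities.\<close>

lemma card_side_orbs_phi_vec:
  assumes "\<And>v. R (pt (phi_vec q v)) = R (pt v)"
  shows "card (side_orbs (phi_vec q l) R) = card (side_orbs l R)"
  using card_side_orbs_phi_vec_le[of R, OF assms, of l]
    card_side_orbs_phi_vec_le[of R, OF assms, of "phi_vec q l"]
    card_side_orbs_phi_vec_le[of R, OF assms, of "phi_vec q (phi_vec q l)"]
  by simp

lemma orb_side_eq_iff: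
  assumes "c \<noteq> 0" "c' \<noteq> 0"
  shows "orb (0, 1, c) = orb (0, 1, c') \<longleftrightarrow> nrm c = nrm c'"
proof
  assume "orb (0, 1, c) = orb (0, 1, c')"
  then obtain t where t: "t \<noteq> 0" "pt (0, 1, c) = pt (0, fr t, fr (fr t) * c')"
    by (auto simp: orb_eq_iff)
  then obtain k where k: "1 = k * fr t" "c = k * (fr (fr t) * c')"
    by (auto simp: pt_eq_iff)
  have "k = 1 / fr t"
    using k(1) t(1) by (simp add: field_simps)
  then have c: "c = fr (fr t) * c' / fr t"
    using k by simp
  show "nrm c = nrm c'"
    unfolding c using t(1) by (simp add: nrm_def)
next
  assume "nrm c = nrm c'"
  then have "nrm (c / c') = 1"
    using assms by (simp add: nrm_divide)
  then obtain t where t: "t \<noteq> 0" "c / c' = fr t / t"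
    using hilbert_90 by blast
  have "c = fr t / t * c'"
    using t assms by (simp add: field_simps)
  \<comment> \<open>The second coordinate is multiplied by \<open>fr\<close> of the group parameter;
    with parameter \<open>fr (fr t)\<close> this is t, and the third factor is \<open>fr t\<close>,
    as the quotient c / c' requires.\<close>
  then have "(0, 1, c) = smul (1 / t) (tw (fr (fr t)) (0, 1, c'))"
    using t(1) by simp
  moreover have "fr (fr t) \<noteq> 0" "1 / t \<noteq> 0"
    using t(1) by simp_all
  ultimately show "orb (0, 1, c) = orb (0, 1, c')"
    using orb_smul orb_tw by metis
qed

lemma side_orbs_eq:
  "side_orbs (1, 0, 0) R = (\<lambda>c. orb (0, 1, c)) ` {c. c \<noteq> 0 \<and> (\<forall>P\<in>orb (0, 1, c). R P)}"
proof (intro equalityI subsetI)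
  fix X assume X: "X \<in> side_orbs (1, 0, 0) R"
  then obtain v where v: "X = orb v" "v \<noteq> (0, 0, 0)"
    by (elim side_orbsE)
  obtain x y z where xyz: "v = (x, y, z)"
    by (cases v)
  have "two_nz v" and perp: "\<forall>t. t \<noteq> 0 \<longrightarrow> dot (tw t v) (1, 0, 0) = 0"
    using X v sls_on_orb_iff[of v "(1, 0, 0)"] by (simp_all add: side_orbs_def)
  then have yz: "x = 0" "y \<noteq> 0" "z \<noteq> 0"
    using perp[rule_format, of 1] xyz by auto
  then have "X = orb (0, 1, z / y)"
    using v xyz orb_smul[of y "(0, 1, z / y)"] by simp
  moreover have "\<forall>P\<in>X. R P"
    using X by (simp add: side_orbs_def)
  ultimately show "X \<in> (\<lambda>c. orb (0, 1, c)) ` {c. c \<noteq> 0 \<and> (\<forall>P\<in>orb (0, 1, c). R P)}"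
    using yz by (intro image_eqI[of _ _ "z / y"]) simp_all
next
  fix X assume "X \<in> (\<lambda>c. orb (0, 1, c)) ` {c. c \<noteq> 0 \<and> (\<forall>P\<in>orb (0, 1, c). R P)}"
  then obtain c where "X = orb (0, 1, c)" "c \<noteq> 0" "\<forall>P\<in>X. R P"
    by blast
  then show "X \<in> side_orbs (1, 0, 0) R"
    using sls_on_orb_iff[of "(0, 1, c)" "(1, 0, 0)"] by (simp add: side_orbs_def)
qed

lemma phi_det_side: "phi_det (0, 1, c) = 1 + nrm c"
  by (simp add: phi_det_def nrm_def algebra_simps)

lemma not_fixed_if_not_nz:
  assumes "v \<noteq> (0, 0, 0)" "\<not> nz v"
  shows "pt (phi_vec q v) \<noteq> pt v"
proof
  assume "pt (phi_vec q v) = pt v"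
  then obtain t where "t \<noteq> 0" "pt v = pt (tw t (1, 1, 1))"
    using fixed_iff[OF assms(1)] by (auto simp: orb_eq)
  then show False
    using nz_pt_cong[of v "tw t (1, 1, 1)"] assms(2) by simp
qed

lemma orb_side_type:
  "(\<forall>P\<in>orb (0, 1, c). pt_typeII q P) \<longleftrightarrow> nrm c = - 1"
  "(\<forall>P\<in>orb (0, 1, c). pt_typeIII q P) \<longleftrightarrow> nrm c \<noteq> - 1"
  using not_fixed_if_not_nz[of "(0, 1, c)"] eq_neg_iff_add_eq_0[of "nrm c" 1]
  by (simp_all add: orb_type pt_typeII_iff pt_typeIII_iff phi_det_side add.commute)

text \<open>The norm is a complete invariant of the orbits on this side and takes every nonzero
  value in F_q. The set K selects the type: {-1} for Type II, its complement for Type III.\<close>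

lemma card_side_orbs_norm:
  "card ((\<lambda>c. orb (0, 1, c)) ` {c. c \<noteq> 0 \<and> nrm c \<in> K}) = card (K \<inter> {k. k \<noteq> 0 \<and> fr k = k})"
proof -
  have "card ((\<lambda>c. orb (0, 1, c)) ` {c. c \<noteq> 0 \<and> nrm c \<in> K}) = card (nrm ` {c. c \<noteq> 0 \<and> nrm c \<in> K})"
    by (rule card_image_cong_fibres) (simp add: orb_side_eq_iff)
  also have "nrm ` {c. c \<noteq> 0 \<and> nrm c \<in> K} = K \<inter> {k. k \<noteq> 0 \<and> fr k = k}"
    unfolding fr_fixed_iff_nrm by blast
  finally show ?thesis .
qed

lemma card_side_orbs:
  "card (side_orbs (1, 0, 0) (pt_typeII q)) = 1"
  "card (side_orbs (1, 0, 0) (pt_typeIII q)) = q - 2"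
proof -
  \<comment> \<open>-1 is one of the q - 1 units of F_q in every characteristic (it is 1 if q is
    even), which leaves q - 2 other norms.\<close>
  have "{- 1} \<inter> {k. k \<noteq> 0 \<and> fr k = k} = {- 1}"
    "- {- 1} \<inter> {k. k \<noteq> 0 \<and> fr k = k} = {k. k \<noteq> 0 \<and> fr k = k} - {- 1}"
    by auto
  then show "card (side_orbs (1, 0, 0) (pt_typeII q)) = 1"
    "card (side_orbs (1, 0, 0) (pt_typeIII q)) = q - 2"
    using card_side_orbs_norm[of "{- 1}"] card_side_orbs_norm[of "- {- 1}"]
    by (simp_all add: side_orbs_eq orb_side_type card_fixed_units card_Diff_singleton)
qed

lemma card_side_orbs_all:
  assumes "l \<in> {(1, 0, 0), (0, 1, 0), (0, 0, 1)}"
  shows "card (side_orbs l (pt_typeII q)) = 1" "card (side_orbs l (pt_typeIII q)) = q - 2"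
proof -
  have l: "(0, 1, 0) = phi_vec q (1, 0, 0 :: 'a)" "(0, 0, 1) = phi_vec q (0, 1, 0 :: 'a)"
    by simp_all
  have "card (side_orbs l R) = card (side_orbs (1, 0, 0) R)"
    if "\<And>v. R (pt (phi_vec q v)) = R (pt v)" for R
    using assms card_side_orbs_phi_vec[of R, OF that] l by (metis empty_iff insert_iff)
  then show "card (side_orbs l (pt_typeII q)) = 1" "card (side_orbs l (pt_typeIII q)) = q - 2"
    using card_side_orbs pt_type_phi_vec by simp_all
qed

lemma side_orb_cases:
  assumes "two_nz v" "\<not> nz v"
  shows "\<exists>l \<in> {(1, 0, 0), (0, 1, 0), (0, 0, 1)}.
    orb v \<in> side_orbs l (pt_typeII q) \<or> orb v \<in> side_orbs l (pt_typeIII q)"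
proof -
  have v: "v \<noteq> (0, 0, 0)"
    using assms two_nz_imp_nonzero by blast
  obtain l where l: "l \<in> {(1, 0, 0), (0, 1, 0), (0, 0, 1 :: 'a)}" "\<And>t. dot (tw t v) l = 0"
  proof -
    obtain x y z where xyz: "v = (x, y, z)"
      by (cases v)
    then consider "x = 0" | "y = 0" | "z = 0"
      using assms by auto
    then show thesis
      using that[of "(1, 0, 0)"] that[of "(0, 1, 0)"] that[of "(0, 0, 1)"] xyz by cases auto
  qed
  then have "sls_on q (pt l) (orb v)"
    using assms v by (simp add: sls_on_orb_iff)
  moreover have "pt_typeII q (pt v) \<or> pt_typeIII q (pt v)"
    using not_fixed_if_not_nz[OF v assms(2)] by (simp add: pt_typeII_iff pt_typeIII_iff)
  ultimately show ?thesis
    using l(1) unfolding side_orbs_def by (auto simp: orb_type simp del: insert_iff)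
qed

lemma orbST_cases:
  assumes "X \<in> orbST q"
  shows "X \<in> {{pt (0, 0, 1)}, {pt (1, 0, 0)}, {pt (0, 1, 0)}} \<or>
    (\<exists>l \<in> {(1, 0, 0), (0, 1, 0), (0, 0, 1)}.
      X \<in> side_orbs l (pt_typeII q) \<or> X \<in> side_orbs l (pt_typeIII q)) \<or> X \<in> plane_orbs"
proof -
  obtain v where v: "X = orb v" "v \<noteq> (0, 0, 0)"
    using assms by (elim orbST_E)
  consider "nz v" | "two_nz v" "\<not> nz v" | "\<not> two_nz v"
    by blast
  then show ?thesis
  proof cases
    case 3
    obtain x y z where xyz: "v = (x, y, z)"
      by (cases v)
    then have "v = smul x (1, 0, 0) \<and> x \<noteq> 0 \<or> v = smul y (0, 1, 0) \<and> y \<noteq> 0 \<or> v = smul z (0, 0, 1) \<and> z \<noteq> 0"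
      using 3 v(2) by auto
    then have "pt v \<in> {pt (0, 0, 1), pt (1, 0, 0), pt (0, 1, 0)}"
      by (elim disjE conjE) (simp_all only: pt_smul insert_iff simp_thms)
    then show ?thesis
      unfolding v(1) orb_vertex[OF v(2) 3] by (elim insertE emptyE) simp_all
  next
    case 2
    then show ?thesis
      unfolding v(1) using side_orb_cases by blast
  qed (simp add: v(1))
qed

lemma orbST_decomposition:
  "orbST q = {{pt (0, 0, 1 :: 'a)}, {pt (1, 0, 0)}, {pt (0, 1, 0)}}
    \<union> (\<Union>l\<in>{(0, 0, 1), (1, 0, 0), (0, 1, 0)}. side_orbs l (pt_typeII q))
    \<union> (\<Union>l\<in>{(0, 0, 1), (1, 0, 0), (0, 1, 0)}. side_orbs l (pt_typeIII q))
    \<union> plane_orbs" (is "_ = ?R")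
proof
  show "orbST q \<subseteq> ?R"
  proof
    fix X :: "'a vec3 set set" assume "X \<in> orbST q"
    from orbST_cases[OF this] show "X \<in> ?R"
      by blast
  qed
next
  have vertices: "{pt (0, 0, 1 :: 'a)} \<in> orbST q" "{pt (1, 0, 0 :: 'a)} \<in> orbST q"
    "{pt (0, 1, 0 :: 'a)} \<in> orbST q"
    using orb_in_orbST[of "(0, 0, 1)"] orb_in_orbST[of "(1, 0, 0)"] orb_in_orbST[of "(0, 1, 0)"]
    by (simp_all add: orb_vertex)
  have sides: "side_orbs l R \<subseteq> orbST q" for l R
    by (auto simp: side_orbs_def sls_on_def)
  have planes: "plane_orbs \<subseteq> orbST q"
    unfolding plane_orbs_def using orb_in_orbST[OF two_nz_imp_nonzero[OF nz_imp_two_nz]] by blast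
  show "?R \<subseteq> orbST q"
    by (intro Un_least UN_least sides planes) (use vertices in simp)
qed

lemma plane_orbs_decomposition:
  "plane_orbs = {P2q q} \<union> plane_orbs_II \<union> plane_orbs_dual_II
    \<union> (plane_orbs - {P2q q} - plane_orbs_II - plane_orbs_dual_II)"
  by (rule Diff_partition3) (auto simp: plane_orbs_II_def plane_orbs_dual_II_def P2q_eq_orb)

text \<open>Each side has the same coordinate vector as the opposite vertex, so one list of three
  vectors describes both the vertices and the sides.\<close>

lemma join_vertices:
  "join (pt (1, 0, 0)) (pt (0, 1, 0)) = pt (0, 0, 1 :: 'a)"
  "join (pt (0, 1, 0)) (pt (0, 0, 1)) = pt (1, 0, 0 :: 'a)"
  "join (pt (0, 0, 1)) (pt (1, 0, 0)) = pt (0, 1, 0 :: 'a)"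
  by (simp_all add: join_pt)

lemma P2q_type:
  "Fq_plane q (P2q q :: 'a vec3 set set)"
  "\<forall>P\<in>(P2q q :: 'a vec3 set set). pt_typeI q P"
  "\<forall>L\<in>plane_lines q (P2q q :: 'a vec3 set set). ln_typeI q L"
  by (simp_all add: P2q_eq_orb Fq_plane_orb orb_type plane_lines_orb ln_type_eq_pt_type pt_typeI_iff)

end

theorem theorem2p1:
  fixes q :: nat
  assumes "\<exists>p k. prime p \<and> 0 < k \<and> q = p ^ k"
    and "card (UNIV :: 'a::{finite, field} set) = q ^ 3"
  shows
   "let T = (Tpt :: 'a vec3 set); T1 = phi q T; T2 = phi q (phi q T);
        Ls = {join T1 T2, join T2 T, join T T1};
        SII = (\<lambda>L. {X. sls_on q L X \<and> (\<forall>P\<in>X. pt_typeII q P)});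
        SIII = (\<lambda>L. {X. sls_on q L X \<and> (\<forall>P\<in>X. pt_typeIII q P)});
        A5 = {X \<in> orbST q. Fq_plane q X \<and> (\<forall>P\<in>X. pt_typeII q P) \<and>
                (\<forall>L\<in>plane_lines q X. ln_typeIII q L)};
        A6 = {X \<in> orbST q. Fq_plane q X \<and> (\<forall>P\<in>X. pt_typeIII q P) \<and>
                (\<forall>L\<in>plane_lines q X. ln_typeII q L)};
        A7 = {X \<in> orbST q. Fq_plane q X \<and> (\<forall>P\<in>X. pt_typeIII q P) \<and>
                (\<forall>L\<in>plane_lines q X. ln_typeIII q L)}
    in orbST q = {{T}, {T1}, {T2}} \<union> (\<Union>L\<in>Ls. SII L) \<union> (\<Union>L\<in>Ls. SIII L)
                 \<union> {P2q q} \<union> A5 \<union> A6 \<union> A7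
     \<and> (\<forall>L\<in>Ls. card (SII L) = 1 \<and> card (SIII L) = q - 2)
     \<and> Fq_plane q (P2q q :: 'a vec3 set set)
     \<and> (\<forall>P\<in>(P2q q :: 'a vec3 set set). pt_typeI q P)
     \<and> (\<forall>L\<in>plane_lines q (P2q q :: 'a vec3 set set). ln_typeI q L)
     \<and> int (card A5) = int q ^ 3 - int q - 3
     \<and> int (card A6) = int q ^ 3 - int q - 3
     \<and> int (card A7) = int q ^ 4 - 3 * int q ^ 3 + int q + 6"
proof -
  interpret cubic_extension q "TYPE('a)"
    by unfold_locales (fact assms)+
  have T: "(Tpt :: 'a vec3 set) = pt (0, 0, 1)" "phi q (pt (0, 0, 1)) = pt (1, 0, 0 :: 'a)"
    "phi q (pt (1, 0, 0)) = pt (0, 1, 0 :: 'a)"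
    by (simp_all add: Tpt_def)
  have sides: "\<forall>L\<in>{pt (0, 0, 1), pt (1, 0, 0), pt (0, 1, 0)}.
      card {X :: 'a vec3 set set. sls_on q L X \<and> (\<forall>P\<in>X. pt_typeII q P)} = 1 \<and>
      card {X :: 'a vec3 set set. sls_on q L X \<and> (\<forall>P\<in>X. pt_typeIII q P)} = q - 2"
    using card_side_orbs_all by (simp add: side_orbs_def)
  show ?thesis
    unfolding Let_def T join_vertices planes_typeII_III planes_typeIII_II planes_typeIII_III
  proof (intro conjI)
    show "orbST q = {{pt (0, 0, 1 :: 'a)}, {pt (1, 0, 0)}, {pt (0, 1, 0)}}
        \<union> (\<Union>L\<in>{pt (0, 0, 1), pt (1, 0, 0), pt (0, 1, 0)}. {X. sls_on q L X \<and> (\<forall>P\<in>X. pt_typeII q P)})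
        \<union> (\<Union>L\<in>{pt (0, 0, 1), pt (1, 0, 0), pt (0, 1, 0)}. {X. sls_on q L X \<and> (\<forall>P\<in>X. pt_typeIII q P)})
        \<union> {P2q q} \<union> plane_orbs_II \<union> plane_orbs_dual_II
        \<union> (plane_orbs - {P2q q} - plane_orbs_II - plane_orbs_dual_II)" (is "_ = ?V \<union> ?A \<union> ?B \<union> ?P \<union> ?C \<union> ?D \<union> ?E")
    proof -
      have "orbST q = ?V \<union> ?A \<union> ?B \<union> plane_orbs"
        using orbST_decomposition unfolding side_orbs_def by simp
      then show ?thesis
        by (subst (asm) plane_orbs_decomposition) (simp only: Un_assoc)
    qed
  qed (rule sides P2q_type card_plane_orbs_II card_planes_typeIII_III
      card_plane_orbs_II[folded card_plane_orbs_dual_II])+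
qed

end
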